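(* Let $G$ be a hereditarily $h$-complete topological group, and let $f: G \rightarrow H$ be a continuous homomorphism onto a topological group $H$. If either (a) $H$ has countable tightness, or (b) $H$ is a $k$-group, then $f$ is open.
   Context: All topological groups are assumed to be Hausdorff. A topological group $G$ is $h$-complete if for every continuous homomorphism $\varphi: G \rightarrow L$ into a topological group $L$, the image $\varphi(G)$ is closed in $L$. $G$ is hereditarily $h$-complete if every closed subgroup of $G$ is $h$-complete. A subset $F$ of a topological space $X$ is $\omega$-closed if $\overline{C} \subseteq F$ for every countable subset $C \subseteq F$ (closure taken in $X$); $X$ has countable tightness if every $\omega$-closed subset of $X$ is closed in $X$. A map $f: X \rightarrow Y$ between Hausdorff spaces is $k$-continuous if its restriction $f|_K$ to every compact subspace $K$ of $X$ is continuous. A topological group $H$ is a $k$-group if every $k$-continuous homomorphism $\varphi: H \rightarrow L$ into a topological group $L$ is continuous. *)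

theory Defs
  imports "HOL-Analysis.Analysis" "HOL-Algebra.Coset"
begin

(* keeps the closure operator of the abstract topology library unambiguous *)
no_notation eq_closure_of (\<open>closure'_of\<index>\<close>)

section \<open>Topological groups\<close>

definition topological_group :: "('a, 'm) monoid_scheme \<Rightarrow> 'a topology \<Rightarrow> bool" where
  "topological_group G T \<longleftrightarrow>
     group G \<and> topspace T = carrier G \<and> Hausdorff_space T \<and>
     continuous_map (prod_topology T T) T (\<lambda>(x, y). x \<otimes>\<^bsub>G\<^esub> y) \<and>
     continuous_map T T (\<lambda>x. inv\<^bsub>G\<^esub> x)"

text \<open>
  HOL cannot quantify over types inside a formula, so in the next definition the targets range
  over the topological groups whose carrier is a set of elements of \<^typ>\<open>'a set set\<close>. This
  loses nothing: one may replace a target by the closure of the image, and every point of a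
  Hausdorff space in the closure of the image is determined by the traces of its neighbourhoods.
  Lemma \<open>h_complete_closed_image\<close> below proves the property for targets over an arbitrary type.
\<close>

definition h_complete :: "('a, 'm) monoid_scheme \<Rightarrow> 'a topology \<Rightarrow> bool" where
  "h_complete G T \<longleftrightarrow>
     (\<forall>(L :: 'a set set monoid) U \<phi>.
        topological_group L U \<and> \<phi> \<in> hom G L \<and> continuous_map T U \<phi>
          \<longrightarrow> closedin U (\<phi> ` carrier G))"

definition hereditarily_h_complete :: "('a, 'm) monoid_scheme \<Rightarrow> 'a topology \<Rightarrow> bool" where
  "hereditarily_h_complete G T \<longleftrightarrow>
     (\<forall>S. subgroup S G \<and> closedin T S \<longrightarrow> h_complete (G\<lparr>carrier := S\<rparr>) (subtopology T S))"


section \<open>Countable tightness and \<open>k\<close>-groups\<close>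

definition omega_closed :: "'a topology \<Rightarrow> 'a set \<Rightarrow> bool" where
  "omega_closed X F \<longleftrightarrow>
     F \<subseteq> topspace X \<and> (\<forall>C. countable C \<and> C \<subseteq> F \<longrightarrow> X closure_of C \<subseteq> F)"

definition countable_tightness :: "'a topology \<Rightarrow> bool" where
  "countable_tightness X \<longleftrightarrow> (\<forall>F. omega_closed X F \<longrightarrow> closedin X F)"

definition k_continuous_map :: "'a topology \<Rightarrow> 'b topology \<Rightarrow> ('a \<Rightarrow> 'b) \<Rightarrow> bool" where
  "k_continuous_map X Y f \<longleftrightarrow>
     (\<forall>K. compactin X K \<longrightarrow> continuous_map (subtopology X K) Y f)"

text \<open>
  Here targets over \<^typ>\<open>'a\<close> itself suffice, because continuity of a homomorphism only depends
  on its image, which embeds into the domain as a set of representatives. Lemma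
  \<open>k_group_continuous\<close> below proves the property for targets over an arbitrary type.
\<close>

definition k_group :: "('a, 'm) monoid_scheme \<Rightarrow> 'a topology \<Rightarrow> bool" where
  "k_group H T \<longleftrightarrow>
     (\<forall>(L :: 'a monoid) U \<phi>.
        topological_group L U \<and> \<phi> \<in> hom H L \<and> k_continuous_map T U \<phi>
          \<longrightarrow> continuous_map T U \<phi>)"


section \<open>Independence of the type of the targets\<close>

lemma topological_groupD:
  assumes "topological_group G T"
  shows "group G" "topspace T = carrier G" "Hausdorff_space T"
    "continuous_map (prod_topology T T) T (\<lambda>(x, y). x \<otimes>\<^bsub>G\<^esub> y)"
    "continuous_map T T (\<lambda>x. inv\<^bsub>G\<^esub> x)"
  using assms by (auto simp: topological_group_def)

lemma topological_group_subgroup: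
  assumes G: "topological_group G T" and S: "subgroup S G"
  shows "topological_group (G\<lparr>carrier := S\<rparr>) (subtopology T S)"
proof -
  interpret group G using topological_groupD(1)[OF G] .
  interpret S: subgroup S G using S .
  have inv: "inv\<^bsub>G\<lparr>carrier := S\<rparr>\<^esub> x = inv\<^bsub>G\<^esub> x" if "x \<in> S" for x
    using that S m_inv_consistent by simp
  have "continuous_map (prod_topology (subtopology T S) (subtopology T S)) (subtopology T S)
          (\<lambda>(x, y). x \<otimes>\<^bsub>G\<^esub> y)"
    using topological_groupD(4)[OF G]
    by (auto simp: continuous_map_in_subtopology prod_topology_subtopology
          subtopology_subtopology intro: continuous_map_from_subtopology)
  moreover have "continuous_map (subtopology T S) (subtopology T S) (\<lambda>x. inv\<^bsub>G\<^esub> x)"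
    using topological_groupD(5)[OF G]
    by (auto simp: continuous_map_in_subtopology intro: continuous_map_from_subtopology)
  then have "continuous_map (subtopology T S) (subtopology T S)
               (\<lambda>x. inv\<^bsub>G\<lparr>carrier := S\<rparr>\<^esub> x)"
    by (rule continuous_map_eq) (auto simp: inv)
  ultimately show ?thesis
    using topological_groupD(2,3)[OF G] S.subset S.subgroup_is_group[OF is_group]
    by (auto simp: topological_group_def Hausdorff_space_subtopology)
qed

lemma topological_group_transport:
  fixes L :: "('l, 'm) monoid_scheme" and e :: "'l \<Rightarrow> 'c"
  assumes L: "topological_group L U" and inj: "inj_on e (carrier L)"
  obtains L' :: "'c monoid" and U' where
    "topological_group L' U'" "e \<in> iso L L'" "homeomorphic_map U U' e"
proof -
  interpret L: group L using topological_groupD(1)[OF L] .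
  define g where "g = inv_into (carrier L) e"
  have ge: "g (e x) = x" if "x \<in> carrier L" for x
    using that inj by (simp add: g_def)
  define L' :: "'c monoid" where
    "L' = \<lparr>carrier = e ` carrier L, mult = (\<lambda>x y. e (g x \<otimes>\<^bsub>L\<^esub> g y)), one = e \<one>\<^bsub>L\<^esub>\<rparr>"
  define U' where "U' = pullback_topology (e ` carrier L) g U"
  have tsU: "topspace U = carrier L" using topological_groupD(2)[OF L] .
  have tsU': "topspace U' = e ` carrier L"
    by (auto simp: U'_def topspace_pullback_topology tsU ge)
  have contg: "continuous_map U' U g"
    using continuous_map_pullback[of U U id] by (simp add: U'_def)
  have "continuous_map U U (g \<circ> e)"
    by (rule continuous_map_eq[OF continuous_map_id]) (simp add: tsU ge)
  then have conte: "continuous_map U U' e"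
    unfolding U'_def by (rule continuous_map_pullback') (simp add: tsU vimage_def subset_iff)
  have hm: "homeomorphic_maps U U' e g"
    using contg conte by (auto simp: homeomorphic_maps_def tsU tsU' ge)
  have grp: "group L'"
  proof (rule groupI)
    fix x assume "x \<in> carrier L'"
    then obtain y where "y \<in> carrier L" "x = e y" by (auto simp: L'_def)
    then show "\<exists>z\<in>carrier L'. z \<otimes>\<^bsub>L'\<^esub> x = \<one>\<^bsub>L'\<^esub>"
      by (intro bexI[of _ "e (inv\<^bsub>L\<^esub> y)"]) (auto simp: L'_def ge)
  qed (auto simp: L'_def ge L.m_assoc)
  have iso: "e \<in> iso L L'"
    using inj by (auto simp: iso_def hom_def L'_def ge bij_betw_def)
  have "group_hom L L' e"
    using grp iso by (auto intro!: group_hom.intro L.is_group simp: group_hom_axioms_def iso_def)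
  then have inv: "inv\<^bsub>L'\<^esub> x = e (inv\<^bsub>L\<^esub> (g x))" if "x \<in> e ` carrier L" for x
    using that by (auto simp: ge group_hom.hom_inv)
  have "continuous_map U' U' (e \<circ> ((\<lambda>x. inv\<^bsub>L\<^esub> x) \<circ> g))"
    by (rule continuous_map_compose[OF continuous_map_compose[OF contg topological_groupD(5)[OF L]] conte])
  then have c_inv: "continuous_map U' U' (\<lambda>x. inv\<^bsub>L'\<^esub> x)"
    by (rule continuous_map_eq) (auto simp: inv tsU' ge)
  have "continuous_map (prod_topology U' U') (prod_topology U U) (\<lambda>(x, y). (g x, g y))"
    using contg by (simp add: continuous_map_prod_top)
  then have "continuous_map (prod_topology U' U') U'
               (e \<circ> ((\<lambda>(x, y). x \<otimes>\<^bsub>L\<^esub> y) \<circ> (\<lambda>(x, y). (g x, g y))))"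
    by (intro continuous_map_compose[OF _ conte] continuous_map_compose[OF _ topological_groupD(4)[OF L]])
  then have c_mult: "continuous_map (prod_topology U' U') U' (\<lambda>(x, y). x \<otimes>\<^bsub>L'\<^esub> y)"
    by (rule continuous_map_eq) (auto simp: L'_def)
  have "Hausdorff_space U'"
    using topological_groupD(3)[OF L] homeomorphic_Hausdorff_space[of U U'] hm
    unfolding homeomorphic_space_def by auto
  then have "topological_group L' U'"
    using grp c_inv c_mult by (simp add: topological_group_def tsU') (simp add: L'_def)
  then show thesis
    using that[of L' U'] iso hm homeomorphic_map_maps[of U U' e] by auto
qed

lemma subgroup_closure_of:
  assumes L: "topological_group L U" and S: "subgroup S L"
  shows "subgroup (U closure_of S) L"
proof -
  interpret L: group L using topological_groupD(1)[OF L] .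
  interpret S: subgroup S L using S .
  have tsU: "topspace U = carrier L" using topological_groupD(2)[OF L] .
  have "(\<lambda>x. inv\<^bsub>L\<^esub> x) ` (U closure_of S) \<subseteq> U closure_of ((\<lambda>x. inv\<^bsub>L\<^esub> x) ` S)"
    using topological_groupD(5)[OF L] by (rule continuous_map_image_closure_subset)
  also have "\<dots> \<subseteq> U closure_of S"
    by (intro closure_of_mono) auto
  finally have i: "inv\<^bsub>L\<^esub> x \<in> U closure_of S" if "x \<in> U closure_of S" for x
    using that by auto
  have "(\<lambda>(x, y). x \<otimes>\<^bsub>L\<^esub> y) ` (prod_topology U U closure_of (S \<times> S))
          \<subseteq> U closure_of ((\<lambda>(x, y). x \<otimes>\<^bsub>L\<^esub> y) ` (S \<times> S))"
    using topological_groupD(4)[OF L] by (rule continuous_map_image_closure_subset)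
  also have "\<dots> \<subseteq> U closure_of S"
    by (intro closure_of_mono) auto
  finally have m: "x \<otimes>\<^bsub>L\<^esub> y \<in> U closure_of S"
    if "x \<in> U closure_of S" "y \<in> U closure_of S" for x y
    using that by (auto simp: closure_of_Times)
  have "S \<subseteq> U closure_of S"
    using S.subset tsU by (simp add: closure_of_subset)
  then show ?thesis
    using i m closure_of_subset_topspace[of U S] tsU S.one_closed
    by (intro subgroup.intro) auto
qed

lemma h_complete_closed_image:
  fixes G :: "('a, 'm) monoid_scheme" and L :: "('l, 'n) monoid_scheme"
  assumes G: "group G" "topspace T = carrier G" and hc: "h_complete G T"
    and L: "topological_group L U" and hom: "\<phi> \<in> hom G L" and cont: "continuous_map T U \<phi>"
  shows "closedin U (\<phi> ` carrier G)"
proof -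
  interpret gh: group_hom G L \<phi>
    using G topological_groupD(1)[OF L] hom
    by (simp add: group_hom.intro group_hom_axioms_def)
  have tsU: "topspace U = carrier L" using topological_groupD(2)[OF L] .
  define S where "S = \<phi> ` carrier G"
  define C where "C = U closure_of S"
  have S: "subgroup S L" unfolding S_def by (rule gh.img_is_subgroup)
  have C: "subgroup C L" unfolding C_def by (rule subgroup_closure_of[OF L S])
  have SC: "S \<subseteq> C"
    unfolding C_def using subgroup.subset[OF S] tsU by (simp add: closure_of_subset)
  define e :: "'l \<Rightarrow> 'a set set" where
    "e = (\<lambda>x. {{a \<in> carrier G. \<phi> a \<in> V} | V. openin U V \<and> x \<in> V})"
  have "inj_on e C"
  proof (rule inj_onI, rule ccontr)
    fix x y assume xy: "x \<in> C" "y \<in> C" "e x = e y" "x \<noteq> y"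
    then have "x \<in> topspace U" "y \<in> topspace U"
      using subgroup.subset[OF C] tsU by auto
    then obtain V W where VW: "openin U V" "openin U W" "x \<in> V" "y \<in> W" "disjnt V W"
      using topological_groupD(3)[OF L] \<open>x \<noteq> y\<close> unfolding Hausdorff_space_def by metis
    then have "{a \<in> carrier G. \<phi> a \<in> V} \<in> e y"
      unfolding xy(3)[symmetric] unfolding e_def by blast
    then obtain W' where W': "openin U W'" "y \<in> W'"
      "{a \<in> carrier G. \<phi> a \<in> V} = {a \<in> carrier G. \<phi> a \<in> W'}"
      unfolding e_def by blast
    have "openin U (W \<inter> W')" "y \<in> W \<inter> W'" using VW W' by auto
    then obtain a where a: "a \<in> carrier G" "\<phi> a \<in> W" "\<phi> a \<in> W'"
      using \<open>y \<in> C\<close> unfolding C_def S_def in_closure_of by blast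
    then show False using W'(3) VW(5) unfolding disjnt_def by blast
  qed
  then obtain L' :: "'a set set monoid" and U' where
    L': "topological_group L' U'" "e \<in> iso (L\<lparr>carrier := C\<rparr>) L'"
      "homeomorphic_map (subtopology U C) U' e"
    using topological_group_transport[OF topological_group_subgroup[OF L C]] by auto
  have "\<phi> \<in> hom G (L\<lparr>carrier := C\<rparr>)"
    using hom SC unfolding hom_def S_def by auto
  then have "e \<circ> \<phi> \<in> hom G L'"
    using L'(2) by (auto intro: hom_compose simp: iso_def)
  moreover have "continuous_map T (subtopology U C) \<phi>"
    using cont SC G(2) by (auto simp: continuous_map_in_subtopology S_def)
  then have "continuous_map T U' (e \<circ> \<phi>)"
    by (rule continuous_map_compose) (rule homeomorphic_imp_continuous_map[OF L'(3)])
  ultimately have "closedin U' (e ` S)"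
    using hc L'(1) unfolding h_complete_def S_def image_comp by blast
  then have "closedin (subtopology U C) S"
    using homeomorphic_map_closedness[OF L'(3)] SC subgroup.subset[OF C] tsU by auto
  then show ?thesis
    unfolding S_def[symmetric] C_def by (rule closedin_trans_full[OF _ closedin_closure_of])
qed

lemma k_group_continuous:
  fixes H :: "('a, 'm) monoid_scheme" and L :: "('l, 'n) monoid_scheme"
  assumes H: "group H" "topspace T = carrier H" and k: "k_group H T"
    and L: "topological_group L U" and hom: "\<phi> \<in> hom H L" and cont: "k_continuous_map T U \<phi>"
  shows "continuous_map T U \<phi>"
proof -
  interpret gh: group_hom H L \<phi>
    using H topological_groupD(1)[OF L] hom
    by (simp add: group_hom.intro group_hom_axioms_def)
  have tsU: "topspace U = carrier L" using topological_groupD(2)[OF L] .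
  define S where "S = \<phi> ` carrier H"
  have S: "subgroup S L" unfolding S_def by (rule gh.img_is_subgroup)
  define e where "e = inv_into (carrier H) \<phi>"
  have "inj_on e S" unfolding e_def S_def by (rule inj_on_inv_into) simp
  then obtain L' :: "'a monoid" and U' where
    L': "topological_group L' U'" "e \<in> iso (L\<lparr>carrier := S\<rparr>) L'"
      "homeomorphic_map (subtopology U S) U' e"
    using topological_group_transport[OF topological_group_subgroup[OF L S]] by auto
  have "\<phi> \<in> hom H (L\<lparr>carrier := S\<rparr>)"
    using hom unfolding hom_def S_def by auto
  then have "e \<circ> \<phi> \<in> hom H L'"
    using L'(2) by (auto intro: hom_compose simp: iso_def)
  moreover have "k_continuous_map T U' (e \<circ> \<phi>)"
    unfolding k_continuous_map_def
  proof (intro allI impI)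
    fix K assume K: "compactin T K"
    then have "continuous_map (subtopology T K) (subtopology U S) \<phi>"
      using cont H(2) by (auto simp: k_continuous_map_def continuous_map_in_subtopology S_def)
    then show "continuous_map (subtopology T K) U' (e \<circ> \<phi>)"
      by (rule continuous_map_compose) (rule homeomorphic_imp_continuous_map[OF L'(3)])
  qed
  ultimately have c: "continuous_map T U' (e \<circ> \<phi>)"
    using k L'(1) unfolding k_group_def by blast
  obtain g where g: "homeomorphic_maps (subtopology U S) U' e g"
    using L'(3) homeomorphic_map_maps by blast
  then have "continuous_map T (subtopology U S) (g \<circ> (e \<circ> \<phi>))"
    by (intro continuous_map_compose[OF c]) (simp add: homeomorphic_maps_def)
  then have "continuous_map T (subtopology U S) \<phi>"
    by (rule continuous_map_eq)
       (use g H(2) tsU subgroup.subset[OF S] in \<open>auto simp: homeomorphic_maps_def S_def\<close>)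
  then show ?thesis
    by (simp add: continuous_map_in_subtopology)
qed

end

theory Submission
  imports Defs
begin

text \<open>
  The images under \<open>f\<close> of the open neighbourhoods of the identity of \<open>G\<close> generate the quotient
  topology on \<open>H\<close>. It is a Hausdorff group topology finer than the given one, and \<open>f\<close> is open
  onto it, so the task is to show that the two topologies of \<open>H\<close> coincide.
  
  The heart of the matter is that they coincide on a closed subgroup that contains any prescribed
  countable set \<open>C\<close>. Lift \<open>C\<close> to \<open>G\<close> and let \<open>S\<close> be the closure of the countable subgroup that
  the lift generates. As \<open>S\<close> is closed, it is \<open>h\<close>-complete; so \<open>f ` S\<close> is closed, and every group
  topology on \<open>f ` S\<close> that is coarser than the quotient topology of \<open>S\<close>, Hausdorff or not, is
  complete (\<open>h_complete_imp_nhds_complete\<close>): adjoining the limit of a non-convergent Cauchy filter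
  would produce a topological group in which the image of \<open>S\<close> is not closed. For a separable group
  this forces minimality (\<open>separable_minimal\<close>). The group topologies with a countable base at the
  identity are then complete and separable, so the theorem of Baire gives an open mapping
  theorem for them (\<open>open_mapping\<close>). The passage to arbitrary topologies uses a filter
  that converges to different points for the two topologies (\<open>common_limit\<close>), and separability
  once more, to replace an uncountable family of neighbourhoods by a countable one.
  
  If \<open>H\<close> has countable tightness, this suffices: a set that is closed for the quotient topology
  contains the closure in \<open>H\<close> of each of its countable subsets. If \<open>H\<close> is a
  \<open>k\<close>-group, let \<open>K\<close> be compact in \<open>H\<close>. A sequence in \<open>K\<close> stays within a closed
  subgroup on which the topologies agree, so it cannot be uniformly discrete for the quotient
  topology, and \<open>K\<close> is totally bounded there. Since the quotient topology is complete, \<open>K\<close> is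
  compact for it; so the two topologies agree on \<open>K\<close>, the identity from \<open>H\<close> to \<open>H\<close> with the
  quotient topology is \<open>k\<close>-continuous, and hence continuous.
\<close>

section \<open>Group topologies from neighbourhoods of the identity\<close>

context group begin
lemma inv_mult_cancel: "x \<in> carrier G \<Longrightarrow> y \<in> carrier G \<Longrightarrow> inv x \<otimes> (x \<otimes> y) = y"
  by (simp flip: m_assoc)
lemma mult_inv_cancel: "x \<in> carrier G \<Longrightarrow> y \<in> carrier G \<Longrightarrow> x \<otimes> (inv x \<otimes> y) = y"
  by (simp flip: m_assoc)
text \<open>
  As rewrite rules these compute a normal form of words in the free group; they settle the
  identities between products of group elements on which the estimates below rest.
\<close>
lemmas group_norm = m_assoc inv_mult_group inv_mult_cancel mult_inv_cancel
end

text \<open>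
  A base of neighbourhoods of the identity, without the condition \<open>\<Inter>B = {\<one>}\<close> that makes the
  topology Hausdorff: the topologies with a countable base that approximate a given
  Hausdorff topology from below are in general not Hausdorff.
\<close>

locale group_nhds = group G for G (structure) +
  fixes B :: "'a set set"
  assumes nonempty: "B \<noteq> {}"
    and sub: "U \<in> B \<Longrightarrow> U \<subseteq> carrier G"
    and one_in: "U \<in> B \<Longrightarrow> \<one> \<in> U"
    and directed: "U \<in> B \<Longrightarrow> V \<in> B \<Longrightarrow> \<exists>W\<in>B. W \<subseteq> U \<inter> V"
    and small_mult: "U \<in> B \<Longrightarrow> \<exists>V\<in>B. \<forall>x\<in>V. \<forall>y\<in>V. x \<otimes> y \<in> U"
    and small_inv: "U \<in> B \<Longrightarrow> \<exists>V\<in>B. \<forall>x\<in>V. inv x \<in> U"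
    and small_conj: "g \<in> carrier G \<Longrightarrow> U \<in> B \<Longrightarrow> \<exists>V\<in>B. \<forall>x\<in>V. g \<otimes> x \<otimes> inv g \<in> U"
begin

lemma mem_carrier [simp]: "U \<in> B \<Longrightarrow> x \<in> U \<Longrightarrow> x \<in> carrier G"
  using sub by blast

lemma small:
  assumes "U \<in> B"
  obtains V where "V \<in> B" "V \<subseteq> U" "\<And>x. x \<in> V \<Longrightarrow> inv x \<in> U"
    "\<And>x y. x \<in> V \<Longrightarrow> y \<in> V \<Longrightarrow> x \<otimes> y \<in> U"
    "\<And>x y. x \<in> V \<Longrightarrow> y \<in> V \<Longrightarrow> inv x \<otimes> y \<in> U"
    "\<And>x y. x \<in> V \<Longrightarrow> y \<in> V \<Longrightarrow> x \<otimes> inv y \<in> U"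
    "\<And>x y z. x \<in> V \<Longrightarrow> y \<in> V \<Longrightarrow> z \<in> V \<Longrightarrow> x \<otimes> y \<otimes> z \<in> U"
proof -
  obtain V1 where V1: "V1 \<in> B" "\<And>x y. x \<in> V1 \<Longrightarrow> y \<in> V1 \<Longrightarrow> x \<otimes> y \<in> U"
    using small_mult[OF assms] by blast
  obtain V2 where V2: "V2 \<in> B" "\<And>x y. x \<in> V2 \<Longrightarrow> y \<in> V2 \<Longrightarrow> x \<otimes> y \<in> V1"
    using small_mult[OF V1(1)] by blast
  obtain V3 where V3: "V3 \<in> B" "\<And>x. x \<in> V3 \<Longrightarrow> inv x \<in> V2"
    using small_inv[OF V2(1)] by blast
  obtain W where W: "W \<in> B" "W \<subseteq> V2" "W \<subseteq> V3"
    using directed[OF V2(1) V3(1)] by auto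
  have a: "x \<in> V1" if "x \<in> V2" for x
    using V2(2)[OF that one_in[OF V2(1)]] mem_carrier[OF V2(1) that] by simp
  have b: "x \<in> U" if "x \<in> V1" for x
    using V1(2)[OF that one_in[OF V1(1)]] mem_carrier[OF V1(1) that] by simp
  have c: "x \<in> V2" "inv x \<in> V2" if "x \<in> W" for x
    using that W V3 by blast+
  show thesis
  proof (rule that[OF W(1)])
    show "W \<subseteq> U" using a b c(1) by blast
  qed (simp_all add: a b c V1(2) V2(2))
qed

end

text \<open>
  The condition is two-sided because a net that is only left Cauchy need not have a left Cauchy
  inverse, so that such nets do not form a group.
\<close>

definition nhds_cauchy :: "('a, 'm) monoid_scheme \<Rightarrow> 'a set set \<Rightarrow> 'a filter \<Rightarrow> bool" where
  "nhds_cauchy G B F \<longleftrightarrow> (\<forall>U\<in>B. \<exists>A. eventually (\<lambda>x. x \<in> A) F \<and> A \<subseteq> carrier G \<and>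
     (\<forall>x\<in>A. \<forall>y\<in>A. inv\<^bsub>G\<^esub> x \<otimes>\<^bsub>G\<^esub> y \<in> U \<and> x \<otimes>\<^bsub>G\<^esub> inv\<^bsub>G\<^esub> y \<in> U))"

definition nhds_limit :: "('a, 'm) monoid_scheme \<Rightarrow> 'a set set \<Rightarrow> 'a filter \<Rightarrow> 'a \<Rightarrow> bool" where
  "nhds_limit G B F z \<longleftrightarrow> z \<in> carrier G \<and> (\<forall>U\<in>B. eventually (\<lambda>x. inv\<^bsub>G\<^esub> z \<otimes>\<^bsub>G\<^esub> x \<in> U) F)"

definition nhds_complete :: "('a, 'm) monoid_scheme \<Rightarrow> 'a set set \<Rightarrow> bool" where
  "nhds_complete G B \<longleftrightarrow> (\<forall>F. F \<noteq> bot \<and> nhds_cauchy G B F \<longrightarrow> (\<exists>z. nhds_limit G B F z))"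

definition nhds_topology :: "('a, 'm) monoid_scheme \<Rightarrow> 'a set set \<Rightarrow> 'a topology" where
  "nhds_topology G B =
     topology (\<lambda>W. W \<subseteq> carrier G \<and> (\<forall>x\<in>W. \<exists>U\<in>B. \<forall>u\<in>U. x \<otimes>\<^bsub>G\<^esub> u \<in> W))"

context group_nhds begin

lemma openin_nhds_topology:
  "openin (nhds_topology G B) W \<longleftrightarrow> W \<subseteq> carrier G \<and> (\<forall>x\<in>W. \<exists>U\<in>B. \<forall>u\<in>U. x \<otimes> u \<in> W)"
proof -
  have "istopology (\<lambda>W. W \<subseteq> carrier G \<and> (\<forall>x\<in>W. \<exists>U\<in>B. \<forall>u\<in>U. x \<otimes> u \<in> W))"
    unfolding istopology_def
  proof (intro conjI allI impI ballI)
    fix S T x assume S: "S \<subseteq> carrier G \<and> (\<forall>x\<in>S. \<exists>U\<in>B. \<forall>u\<in>U. x \<otimes> u \<in> S)"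
      and T: "T \<subseteq> carrier G \<and> (\<forall>x\<in>T. \<exists>U\<in>B. \<forall>u\<in>U. x \<otimes> u \<in> T)" and x: "x \<in> S \<inter> T"
    then obtain U V where "U \<in> B" "\<forall>u\<in>U. x \<otimes> u \<in> S" "V \<in> B" "\<forall>u\<in>V. x \<otimes> u \<in> T"
      by blast
    then show "\<exists>U\<in>B. \<forall>u\<in>U. x \<otimes> u \<in> S \<inter> T"
      using directed[of U V] by blast
  next
    fix \<K> x assume "\<forall>K\<in>\<K>. K \<subseteq> carrier G \<and> (\<forall>x\<in>K. \<exists>U\<in>B. \<forall>u\<in>U. x \<otimes> u \<in> K)" "x \<in> \<Union>\<K>"
    then show "\<exists>U\<in>B. \<forall>u\<in>U. x \<otimes> u \<in> \<Union>\<K>" by (meson UnionE UnionI)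
  qed blast+
  then show ?thesis by (simp add: nhds_topology_def)
qed

lemma topspace_nhds_topology: "topspace (nhds_topology G B) = carrier G"
proof
  have "openin (nhds_topology G B) (carrier G)"
    unfolding openin_nhds_topology using nonempty by fastforce
  then show "carrier G \<subseteq> topspace (nhds_topology G B)" by (rule openin_subset)
  show "topspace (nhds_topology G B) \<subseteq> carrier G"
    using openin_nhds_topology openin_topspace by blast
qed

text \<open>
  The translate \<open>x U\<close> itself need not be open; the points \<open>y\<close> for which some \<open>y V\<close> is contained
  in \<open>x U\<close> form an open neighbourhood of \<open>x\<close> inside it.
\<close>

lemma open_nhd:
  assumes U: "U \<in> B" and x: "x \<in> carrier G"
  obtains W where "openin (nhds_topology G B) W" "x \<in> W" "\<And>y. y \<in> W \<Longrightarrow> inv x \<otimes> y \<in> U"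
proof -
  define W where "W = {y \<in> carrier G. \<exists>V\<in>B. \<forall>v\<in>V. inv x \<otimes> y \<otimes> v \<in> U}"
  have "\<exists>U\<in>B. \<forall>u\<in>U. y \<otimes> u \<in> W" if y: "y \<in> W" for y
  proof -
    have yc: "y \<in> carrier G" using y by (simp add: W_def)
    obtain V where V: "V \<in> B" "\<forall>v\<in>V. inv x \<otimes> y \<otimes> v \<in> U" using y unfolding W_def by blast
    obtain V' where V': "V' \<in> B" "\<forall>x\<in>V'. \<forall>y\<in>V'. x \<otimes> y \<in> V" using small_mult[OF V(1)] by blast
    have "y \<otimes> u \<in> W" if "u \<in> V'" for u
      unfolding W_def
    proof (intro CollectI conjI bexI[OF _ V'(1)] ballI)
      show "y \<otimes> u \<in> carrier G" using yc V'(1) that by simp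
      fix v assume v: "v \<in> V'"
      then have "inv x \<otimes> (y \<otimes> u) \<otimes> v = inv x \<otimes> y \<otimes> (u \<otimes> v)"
        using V'(1) that yc x by (simp add: m_assoc)
      then show "inv x \<otimes> (y \<otimes> u) \<otimes> v \<in> U" using V V' that v by simp
    qed
    then show ?thesis using V'(1) by blast
  qed
  then have "openin (nhds_topology G B) W"
    unfolding openin_nhds_topology by (auto simp: W_def)
  moreover have "x \<in> W"
    using x U by (auto simp: W_def intro!: bexI[OF _ U])
  moreover have "inv x \<otimes> y \<in> U" if y: "y \<in> W" for y
  proof -
    obtain V where "V \<in> B" "\<forall>v\<in>V. inv x \<otimes> y \<otimes> v \<in> U" "y \<in> carrier G"
      using y unfolding W_def by blast
    then show ?thesis using one_in[of V] x by fastforce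
  qed
  ultimately show thesis using that by blast
qed

lemma topological_group_nhds_topology:
  assumes H: "\<Inter>B \<subseteq> {\<one>}"
  shows "topological_group G (nhds_topology G B)"
proof -
  let ?T = "nhds_topology G B"
  have "Hausdorff_space ?T"
    unfolding Hausdorff_space_def topspace_nhds_topology
  proof (intro allI impI)
    fix x y assume xy: "x \<in> carrier G \<and> y \<in> carrier G \<and> x \<noteq> y"
    then have "inv x \<otimes> y \<noteq> \<one>"
      by (metis inv_closed inv_equality inv_inv)
    then obtain U where U: "U \<in> B" "inv x \<otimes> y \<notin> U" using H by blast
    obtain V where V: "V \<in> B" "\<And>x y. x \<in> V \<Longrightarrow> y \<in> V \<Longrightarrow> x \<otimes> inv y \<in> U"
      using small[OF U(1)] by metis
    obtain X where X: "openin ?T X" "x \<in> X" "\<And>z. z \<in> X \<Longrightarrow> inv x \<otimes> z \<in> V"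
      using open_nhd[OF V(1)] xy by metis
    obtain Y where Y: "openin ?T Y" "y \<in> Y" "\<And>z. z \<in> Y \<Longrightarrow> inv y \<otimes> z \<in> V"
      using open_nhd[OF V(1)] xy by metis
    have "False" if "z \<in> X" "z \<in> Y" for z
    proof -
      have "z \<in> carrier G" using X(1) that openin_subset topspace_nhds_topology by blast
      then have "inv x \<otimes> y = (inv x \<otimes> z) \<otimes> inv (inv y \<otimes> z)"
        using xy by (simp add: group_norm)
      then show False using U(2) V(2) X(3) Y(3) that by metis
    qed
    then show "\<exists>U V. openin ?T U \<and> openin ?T V \<and> x \<in> U \<and> y \<in> V \<and> disjnt U V"
      using X Y unfolding disjnt_def by blast
  qed
  moreover have "continuous_map ?T ?T (\<lambda>x. inv x)"
    unfolding continuous_map_def topspace_nhds_topology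
  proof (intro conjI allI impI)
    fix W assume W: "openin ?T W"
    show "openin ?T {x \<in> carrier G. inv x \<in> W}"
      unfolding openin_nhds_topology
    proof (intro conjI ballI)
      fix x assume x: "x \<in> {x \<in> carrier G. inv x \<in> W}"
      then obtain U where U: "U \<in> B" "\<forall>u\<in>U. inv x \<otimes> u \<in> W"
        using W unfolding openin_nhds_topology by blast
      obtain V where V: "V \<in> B" "\<forall>v\<in>V. x \<otimes> v \<otimes> inv x \<in> U"
        using small_conj[OF _ U(1)] x by blast
      obtain V' where V': "V' \<in> B" "\<forall>v\<in>V'. inv v \<in> V"
        using small_inv[OF V(1)] by blast
      have "inv (x \<otimes> v) \<in> W" if v: "v \<in> V'" for v
      proof -
        have "inv (x \<otimes> v) = inv x \<otimes> (x \<otimes> inv v \<otimes> inv x)"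
          using x v V'(1) by (simp add: group_norm)
        then show ?thesis using U V V' v by simp
      qed
      then show "\<exists>U\<in>B. \<forall>u\<in>U. x \<otimes> u \<in> {x \<in> carrier G. inv x \<in> W}"
        using V'(1) x by auto
    qed auto
  qed auto
  moreover have "continuous_map (prod_topology ?T ?T) ?T (\<lambda>(x, y). x \<otimes> y)"
    unfolding continuous_map_def topspace_nhds_topology topspace_prod_topology
  proof (intro conjI allI impI)
    fix W assume W: "openin ?T W"
    show "openin (prod_topology ?T ?T)
        {p \<in> carrier G \<times> carrier G. (case p of (x, y) \<Rightarrow> x \<otimes> y) \<in> W}"
      unfolding openin_prod_topology_alt
    proof (intro allI impI)
      fix x y assume "(x, y) \<in> {p \<in> carrier G \<times> carrier G. (case p of (x, y) \<Rightarrow> x \<otimes> y) \<in> W}"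
      then have xy: "x \<in> carrier G" "y \<in> carrier G" "x \<otimes> y \<in> W" by auto
      obtain U where U: "U \<in> B" "\<forall>u\<in>U. x \<otimes> y \<otimes> u \<in> W"
        using W xy unfolding openin_nhds_topology by blast
      obtain V where V: "V \<in> B" "\<forall>u\<in>V. \<forall>v\<in>V. u \<otimes> v \<in> U"
        using small_mult[OF U(1)] by blast
      obtain V' where V': "V' \<in> B" "\<forall>v\<in>V'. inv y \<otimes> v \<otimes> inv (inv y) \<in> V"
        using small_conj[OF _ V(1)] xy by blast
      obtain X where X: "openin ?T X" "x \<in> X" "\<And>z. z \<in> X \<Longrightarrow> inv x \<otimes> z \<in> V'"
        using open_nhd[OF V'(1) xy(1)] by metis
      obtain Y where Y: "openin ?T Y" "y \<in> Y" "\<And>z. z \<in> Y \<Longrightarrow> inv y \<otimes> z \<in> V"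
        using open_nhd[OF V(1) xy(2)] by metis
      have "a \<otimes> b \<in> W" "a \<in> carrier G" "b \<in> carrier G" if ab: "a \<in> X" "b \<in> Y" for a b
      proof -
        show c: "a \<in> carrier G" "b \<in> carrier G"
          using X(1) Y(1) ab openin_subset topspace_nhds_topology by blast+
        then have "a \<otimes> b = x \<otimes> y \<otimes> ((inv y \<otimes> (inv x \<otimes> a) \<otimes> inv (inv y)) \<otimes> (inv y \<otimes> b))"
          using xy by (simp add: group_norm)
        then show "a \<otimes> b \<in> W" using U V V' X(3)[OF ab(1)] Y(3)[OF ab(2)] by simp
      qed
      then show "\<exists>U V. openin ?T U \<and> openin ?T V \<and> x \<in> U \<and> y \<in> V \<and>
          U \<times> V \<subseteq> {p \<in> carrier G \<times> carrier G. (case p of (x, y) \<Rightarrow> x \<otimes> y) \<in> W}"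
        using X Y by (intro exI[of _ X] exI[of _ Y]) auto
    qed
  qed auto
  ultimately show ?thesis
    by (simp add: topological_group_def topspace_nhds_topology is_group)
qed

lemma group_nhds_image:
  assumes H: "group H" and f: "f \<in> hom G H" and onto: "f ` carrier G = carrier H"
  shows "group_nhds H ((\<lambda>U. f ` U) ` B)"
proof -
  interpret gh: group_hom G H f
    using H f by (simp add: group_hom.intro group_hom_axioms_def is_group)
  show ?thesis
  proof (intro group_nhds.intro group_nhds_axioms.intro H)
    fix P assume "P \<in> (\<lambda>U. f ` U) ` B"
    then obtain U where U: "U \<in> B" "P = f ` U" by blast
    show "P \<subseteq> carrier H" using U sub onto by blast
    show "\<one>\<^bsub>H\<^esub> \<in> P" using U one_in gh.hom_one by (metis imageI)
    obtain V where V: "V \<in> B" "\<forall>x\<in>V. \<forall>y\<in>V. x \<otimes> y \<in> U" using small_mult U(1) by blast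
    have "f x \<otimes>\<^bsub>H\<^esub> f y \<in> P" if "x \<in> V" "y \<in> V" for x y
      using U V that gh.hom_mult[of x y] by (metis mem_carrier imageI)
    then show "\<exists>V\<in>(\<lambda>U. f ` U) ` B. \<forall>x\<in>V. \<forall>y\<in>V. x \<otimes>\<^bsub>H\<^esub> y \<in> P"
      using V(1) by (intro bexI[of _ "f ` V"]) auto
    obtain V where V: "V \<in> B" "\<forall>x\<in>V. inv x \<in> U" using small_inv U(1) by blast
    have "inv\<^bsub>H\<^esub> (f x) \<in> P" if "x \<in> V" for x
      using U V that gh.hom_inv[of x] by (metis mem_carrier imageI)
    then show "\<exists>V\<in>(\<lambda>U. f ` U) ` B. \<forall>x\<in>V. inv\<^bsub>H\<^esub> x \<in> P"
      using V(1) by (intro bexI[of _ "f ` V"]) auto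
    fix h assume "h \<in> carrier H"
    then obtain g where g: "g \<in> carrier G" "h = f g" using onto by blast
    obtain V where V: "V \<in> B" "\<forall>x\<in>V. g \<otimes> x \<otimes> inv g \<in> U" using small_conj g U(1) by blast
    have "h \<otimes>\<^bsub>H\<^esub> f x \<otimes>\<^bsub>H\<^esub> inv\<^bsub>H\<^esub> h \<in> P" if "x \<in> V" for x
    proof -
      have "h \<otimes>\<^bsub>H\<^esub> f x \<otimes>\<^bsub>H\<^esub> inv\<^bsub>H\<^esub> h = f (g \<otimes> x \<otimes> inv g)"
        using V(1) that g by simp
      then show ?thesis using U V that by simp
    qed
    then show "\<exists>V\<in>(\<lambda>U. f ` U) ` B. \<forall>x\<in>V. h \<otimes>\<^bsub>H\<^esub> x \<otimes>\<^bsub>H\<^esub> inv\<^bsub>H\<^esub> h \<in> P"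
      using V(1) by (intro bexI[of _ "f ` V"]) auto
  next
    fix P Q assume "P \<in> (\<lambda>U. f ` U) ` B" "Q \<in> (\<lambda>U. f ` U) ` B"
    then obtain U V where "U \<in> B" "P = f ` U" "V \<in> B" "Q = f ` V" by blast
    then show "\<exists>W\<in>(\<lambda>U. f ` U) ` B. W \<subseteq> P \<inter> Q"
      using directed[of U V] by blast
  qed (use nonempty in simp)
qed

text \<open>
  \<open>\<Inter>B\<close> is the closure of the identity, and dividing by it gives the associated Hausdorff group.
\<close>

lemma normal_Inter: "\<Inter>B \<lhd> G"
proof -
  have "subgroup (\<Inter>B) G"
  proof (rule subgroupI)
    show "\<Inter>B \<subseteq> carrier G" using sub nonempty by blast
    show "\<Inter>B \<noteq> {}" using one_in by blast
    show "inv a \<in> \<Inter>B" if "a \<in> \<Inter>B" for a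
      using that small_inv by blast
    show "a \<otimes> b \<in> \<Inter>B" if "a \<in> \<Inter>B" "b \<in> \<Inter>B" for a b
      using that small_mult by blast
  qed
  moreover have "x \<otimes> h \<otimes> inv x \<in> \<Inter>B" if "x \<in> carrier G" "h \<in> \<Inter>B" for x h
    using that small_conj[OF that(1)] by blast
  ultimately show ?thesis using normal_inv_iff by blast
qed

lemma quotient_hom: "(\<lambda>x. \<Inter>B #> x) \<in> hom G (G Mod \<Inter>B)"
  using normal.r_coset_hom_Mod[OF normal_Inter] .

lemma group_nhds_quotient:
  "group_nhds (G Mod \<Inter>B) ((\<lambda>U. (\<lambda>x. \<Inter>B #> x) ` U) ` B)"
  using normal.factorgroup_is_group[OF normal_Inter] quotient_hom
  by (rule group_nhds_image) (simp add: carrier_FactGroup)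

lemma topological_group_quotient:
  "topological_group (G Mod \<Inter>B)
     (nhds_topology (G Mod \<Inter>B) ((\<lambda>U. (\<lambda>x. \<Inter>B #> x) ` U) ` B))"
proof (rule group_nhds.topological_group_nhds_topology[OF group_nhds_quotient], rule subsetI)
  interpret N: normal "\<Inter>B" G by (rule normal_Inter)
  fix X assume X: "X \<in> \<Inter>((\<lambda>U. (\<lambda>x. \<Inter>B #> x) ` U) ` B)"
  obtain U0 where "U0 \<in> B" using nonempty by blast
  then obtain x where x: "x \<in> U0" "X = \<Inter>B #> x" using X by blast
  then have xc: "x \<in> carrier G" using \<open>U0 \<in> B\<close> by simp
  have "x \<in> U" if "U \<in> B" for U
  proof -
    obtain V where V: "V \<in> B" "\<forall>x\<in>V. \<forall>y\<in>V. x \<otimes> y \<in> U" using small_mult \<open>U \<in> B\<close> by blast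
    then obtain v where v: "v \<in> V" "\<Inter>B #> x = \<Inter>B #> v" using X x by blast
    then have "x \<in> \<Inter>B #> v" using rcos_self[OF xc N.is_subgroup] by simp
    then obtain n where "n \<in> \<Inter>B" "x = n \<otimes> v" unfolding r_coset_def by blast
    then show "x \<in> U" using V v by blast
  qed
  then have "x \<in> \<Inter>B" by blast
  then have "X = \<Inter>B" using x(2) coset_join2[OF xc N.is_subgroup] by simp
  then show "X \<in> {\<one>\<^bsub>G Mod \<Inter>B\<^esub>}" by simp
qed

(* As U does not occur in the conclusion, the rule is too costly for rewriting in interpretations. *)
declare mem_carrier [simp del]

end

lemma group_nhds_open:
  assumes T: "topological_group G T"
  shows "group_nhds G {W. openin T W \<and> \<one>\<^bsub>G\<^esub> \<in> W}"
proof -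
  interpret group G using topological_groupD(1)[OF T] .
  have ts: "topspace T = carrier G" using topological_groupD(2)[OF T] .
  show ?thesis
  proof (intro group_nhds.intro group_nhds_axioms.intro is_group)
    show "{W. openin T W \<and> \<one>\<^bsub>G\<^esub> \<in> W} \<noteq> {}"
      using openin_topspace[of T] ts by auto
    fix U assume "U \<in> {W. openin T W \<and> \<one>\<^bsub>G\<^esub> \<in> W}"
    then have U: "openin T U" "\<one>\<^bsub>G\<^esub> \<in> U" by auto
    show "U \<subseteq> carrier G" using openin_subset[OF U(1)] ts by simp
    show "\<one>\<^bsub>G\<^esub> \<in> U" by (rule U(2))
    show "\<exists>W\<in>{W. openin T W \<and> \<one>\<^bsub>G\<^esub> \<in> W}. W \<subseteq> U \<inter> V"
      if "V \<in> {W. openin T W \<and> \<one>\<^bsub>G\<^esub> \<in> W}" for V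
      using that U by (intro bexI[of _ "U \<inter> V"]) auto
    define P where
      "P = {p \<in> topspace (prod_topology T T). (case p of (x, y) \<Rightarrow> x \<otimes>\<^bsub>G\<^esub> y) \<in> U}"
    have "openin (prod_topology T T) P"
      unfolding P_def using topological_groupD(4)[OF T] U(1) by (rule openin_continuous_map_preimage)
    moreover have "(\<one>\<^bsub>G\<^esub>, \<one>\<^bsub>G\<^esub>) \<in> P" using U ts by (simp add: P_def)
    ultimately obtain V V' where V: "openin T V" "openin T V'" "\<one>\<^bsub>G\<^esub> \<in> V" "\<one>\<^bsub>G\<^esub> \<in> V'"
      "V \<times> V' \<subseteq> P"
      unfolding openin_prod_topology_alt by meson
    have "x \<otimes>\<^bsub>G\<^esub> y \<in> U" if "x \<in> V" "y \<in> V'" for x y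
    proof -
      have "(x, y) \<in> P" using V(5) that by blast
      then show ?thesis by (simp add: P_def)
    qed
    then show "\<exists>V\<in>{W. openin T W \<and> \<one>\<^bsub>G\<^esub> \<in> W}. \<forall>x\<in>V. \<forall>y\<in>V. x \<otimes>\<^bsub>G\<^esub> y \<in> U"
      using V(1-4) by (intro bexI[of _ "V \<inter> V'"]) auto
    have "openin T {x \<in> topspace T. inv\<^bsub>G\<^esub> x \<in> U}"
      using topological_groupD(5)[OF T] U(1) by (rule openin_continuous_map_preimage)
    then show "\<exists>V\<in>{W. openin T W \<and> \<one>\<^bsub>G\<^esub> \<in> W}. \<forall>x\<in>V. inv\<^bsub>G\<^esub> x \<in> U"
      using U(2) ts by (intro bexI[of _ "{x \<in> topspace T. inv\<^bsub>G\<^esub> x \<in> U}"]) auto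
    fix g assume g: "g \<in> carrier G"
    have "continuous_map T (prod_topology T T) (\<lambda>x. (g, x))"
      using g by (simp add: continuous_map_pairwise o_def ts)
    then have "continuous_map T T ((\<lambda>(x, y). x \<otimes>\<^bsub>G\<^esub> y) \<circ> (\<lambda>x. (g, x)))"
      by (rule continuous_map_compose) (rule topological_groupD(4)[OF T])
    then have "continuous_map T (prod_topology T T) (\<lambda>x. (g \<otimes>\<^bsub>G\<^esub> x, inv\<^bsub>G\<^esub> g))"
      using g by (simp add: continuous_map_pairwise o_def ts)
    then have "continuous_map T T ((\<lambda>(x, y). x \<otimes>\<^bsub>G\<^esub> y) \<circ> (\<lambda>x. (g \<otimes>\<^bsub>G\<^esub> x, inv\<^bsub>G\<^esub> g)))"
      by (rule continuous_map_compose) (rule topological_groupD(4)[OF T])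
    then have "openin T {x \<in> topspace T. ((\<lambda>(x, y). x \<otimes>\<^bsub>G\<^esub> y) \<circ> (\<lambda>x. (g \<otimes>\<^bsub>G\<^esub> x, inv\<^bsub>G\<^esub> g))) x \<in> U}"
      using U(1) by (rule openin_continuous_map_preimage)
    then show "\<exists>V\<in>{W. openin T W \<and> \<one>\<^bsub>G\<^esub> \<in> W}. \<forall>x\<in>V. g \<otimes>\<^bsub>G\<^esub> x \<otimes>\<^bsub>G\<^esub> inv\<^bsub>G\<^esub> g \<in> U"
      using U(2) ts g
      by (intro bexI[of _ "{x \<in> topspace T. ((\<lambda>(x, y). x \<otimes>\<^bsub>G\<^esub> y) \<circ> (\<lambda>x. (g \<otimes>\<^bsub>G\<^esub> x, inv\<^bsub>G\<^esub> g))) x \<in> U}"]) auto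
  qed
qed

lemma Inter_open_nhds:
  assumes T: "topological_group G T"
  shows "\<Inter>{W. openin T W \<and> \<one>\<^bsub>G\<^esub> \<in> W} \<subseteq> {\<one>\<^bsub>G\<^esub>}"
proof
  interpret group G using topological_groupD(1)[OF T] .
  have ts: "topspace T = carrier G" using topological_groupD(2)[OF T] .
  fix x assume x: "x \<in> \<Inter>{W. openin T W \<and> \<one>\<^bsub>G\<^esub> \<in> W}"
  show "x \<in> {\<one>\<^bsub>G\<^esub>}"
  proof (rule ccontr)
    assume "x \<notin> {\<one>\<^bsub>G\<^esub>}"
    moreover have "x \<in> topspace T" using x openin_topspace[of T] ts by auto
    ultimately obtain U V where "openin T U" "openin T V" "\<one>\<^bsub>G\<^esub> \<in> U" "x \<in> V" "disjnt U V"
      using topological_groupD(3)[OF T] one_closed ts unfolding Hausdorff_space_def by (metis singletonI)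
    then show False using x unfolding disjnt_def by blast
  qed
qed

lemma openin_left_translate:
  assumes T: "topological_group G T" and O: "openin T W" and g: "g \<in> carrier G"
  shows "openin T {x \<in> carrier G. inv\<^bsub>G\<^esub> g \<otimes>\<^bsub>G\<^esub> x \<in> W}"
proof -
  interpret group G using topological_groupD(1)[OF T] .
  have ts: "topspace T = carrier G" using topological_groupD(2)[OF T] .
  have "continuous_map T (prod_topology T T) (\<lambda>x. (inv\<^bsub>G\<^esub> g, x))"
    using g by (simp add: continuous_map_pairwise o_def ts)
  then have "continuous_map T T ((\<lambda>(x, y). x \<otimes>\<^bsub>G\<^esub> y) \<circ> (\<lambda>x. (inv\<^bsub>G\<^esub> g, x)))"
    by (rule continuous_map_compose) (rule topological_groupD(4)[OF T])
  then have "continuous_map T T (\<lambda>x. inv\<^bsub>G\<^esub> g \<otimes>\<^bsub>G\<^esub> x)" by (simp add: o_def)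
  then show ?thesis using openin_continuous_map_preimage[OF _ O, of T "\<lambda>x. inv\<^bsub>G\<^esub> g \<otimes>\<^bsub>G\<^esub> x"] ts by simp
qed

lemma continuous_hom_nhds_topology:
  assumes T: "topological_group G T" and B: "group_nhds H B" and f: "f \<in> hom G H"
    and small: "\<And>U. U \<in> B \<Longrightarrow> \<exists>W. openin T W \<and> \<one>\<^bsub>G\<^esub> \<in> W \<and> f ` W \<subseteq> U"
  shows "continuous_map T (nhds_topology H B) f"
  unfolding continuous_map_def
proof (intro conjI allI impI)
  interpret H: group_nhds H B by (rule B)
  interpret gh: group_hom G H f
    by (intro group_hom.intro group_hom_axioms.intro topological_groupD(1)[OF T] H.is_group f)
  have ts: "topspace T = carrier G" using topological_groupD(2)[OF T] .
  show "f \<in> topspace T \<rightarrow> topspace (nhds_topology H B)"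
    unfolding ts H.topspace_nhds_topology by (rule Pi_I) (rule gh.hom_closed)
  fix W assume W: "openin (nhds_topology H B) W"
  show "openin T {x \<in> topspace T. f x \<in> W}"
  proof (subst openin_subopen, intro ballI)
    fix x assume x: "x \<in> {x \<in> topspace T. f x \<in> W}"
    then have xc: "x \<in> carrier G" using ts by simp
    obtain U where U: "U \<in> B" "\<forall>u\<in>U. f x \<otimes>\<^bsub>H\<^esub> u \<in> W"
      using W x unfolding H.openin_nhds_topology by blast
    obtain V where V: "openin T V" "\<one>\<^bsub>G\<^esub> \<in> V" "f ` V \<subseteq> U" using small[OF U(1)] by blast
    have "f y \<in> W" if "y \<in> carrier G" "inv\<^bsub>G\<^esub> x \<otimes>\<^bsub>G\<^esub> y \<in> V" for y
    proof -
      have "f x \<otimes>\<^bsub>H\<^esub> f (inv\<^bsub>G\<^esub> x \<otimes>\<^bsub>G\<^esub> y) = f y"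
        using xc that(1) by (simp add: H.group_norm)
      then show ?thesis using U V that by (metis image_subset_iff)
    qed
    then show "\<exists>T'. openin T T' \<and> x \<in> T' \<and> T' \<subseteq> {x \<in> topspace T. f x \<in> W}"
      using openin_left_translate[OF T V(1) xc] V(2) xc ts
      by (intro exI[of _ "{y \<in> carrier G. inv\<^bsub>G\<^esub> x \<otimes>\<^bsub>G\<^esub> y \<in> V}"]) auto
  qed
qed

section \<open>Completeness of coarser group topologies\<close>

text \<open>
  To find the limit of a single filter \<open>F\<close>, the whole completion is not needed: the Cauchy nets
  that are indexed by \<open>F\<close>, taken modulo those that converge to the identity, already form a
  topological group that contains both the given group, as the constant nets, and the
  point to which \<open>F\<close> should converge.
\<close>

definition left_cauchy :: "('a, 'm) monoid_scheme \<Rightarrow> 'a set set \<Rightarrow> 'i filter \<Rightarrow> ('i \<Rightarrow> 'a) \<Rightarrow> bool" where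
  "left_cauchy G B F x \<longleftrightarrow>
     (\<forall>U\<in>B. \<exists>P. eventually P F \<and> (\<forall>i j. P i \<longrightarrow> P j \<longrightarrow> inv\<^bsub>G\<^esub> (x i) \<otimes>\<^bsub>G\<^esub> x j \<in> U))"

definition cauchy_nets :: "('a, 'm) monoid_scheme \<Rightarrow> 'a set set \<Rightarrow> 'i filter \<Rightarrow> ('i \<Rightarrow> 'a) set" where
  "cauchy_nets G B F = {x. (\<forall>i. x i \<in> carrier G) \<and> left_cauchy G B F x \<and>
     left_cauchy G B F (\<lambda>i. inv\<^bsub>G\<^esub> (x i))}"

definition net_group :: "('a, 'm) monoid_scheme \<Rightarrow> 'a set set \<Rightarrow> 'i filter \<Rightarrow> ('i \<Rightarrow> 'a) monoid" where
  "net_group G B F = \<lparr>carrier = cauchy_nets G B F, mult = (\<lambda>x y i. x i \<otimes>\<^bsub>G\<^esub> y i), one = (\<lambda>i. \<one>\<^bsub>G\<^esub>)\<rparr>"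

definition net_nhds :: "('a, 'm) monoid_scheme \<Rightarrow> 'a set set \<Rightarrow> 'i filter \<Rightarrow> ('i \<Rightarrow> 'a) set set" where
  "net_nhds G B F = (\<lambda>U. {x \<in> cauchy_nets G B F. eventually (\<lambda>i. x i \<in> U) F}) ` B"

context group_nhds begin

text \<open>
  The factor \<open>x\<^sub>i\<inverse> x\<^sub>j\<close> in the middle of \<open>y\<^sub>i\<inverse> x\<^sub>i\<inverse> x\<^sub>j y\<^sub>j\<close> is conjugated by a variable element.
  Since \<open>y\<close> is left Cauchy, this differs little from the conjugation by one fixed \<open>y\<^sub>k\<close>.
\<close>

lemma left_cauchy_mult:
  assumes F: "F \<noteq> bot" and xc: "\<And>i. x i \<in> carrier G" and yc: "\<And>i. y i \<in> carrier G"
    and x: "left_cauchy G B F x" and y: "left_cauchy G B F y"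
  shows "left_cauchy G B F (\<lambda>i. x i \<otimes> y i)"
  unfolding left_cauchy_def
proof
  fix U assume U: "U \<in> B"
  obtain V where V: "V \<in> B" "\<And>x y z. x \<in> V \<Longrightarrow> y \<in> V \<Longrightarrow> z \<in> V \<Longrightarrow> x \<otimes> y \<otimes> z \<in> U"
    using small[OF U] by metis
  obtain P where P: "eventually P F" "\<And>i j. P i \<Longrightarrow> P j \<Longrightarrow> inv (y i) \<otimes> y j \<in> V"
    using y V(1) unfolding left_cauchy_def by meson
  obtain k where k: "P k" using eventually_happens'[OF F P(1)] by blast
  define g where "g = y k"
  have g: "g \<in> carrier G" using yc g_def by simp
  obtain W where W: "W \<in> B" "\<forall>w\<in>W. inv g \<otimes> w \<otimes> inv (inv g) \<in> V"
    using small_conj[OF inv_closed[OF g] V(1)] by blast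
  obtain Q where Q: "eventually Q F" "\<And>i j. Q i \<Longrightarrow> Q j \<Longrightarrow> inv (x i) \<otimes> x j \<in> W"
    using x W(1) unfolding left_cauchy_def by meson
  have "inv (x i \<otimes> y i) \<otimes> (x j \<otimes> y j) \<in> U" if "P i \<and> Q i" "P j \<and> Q j" for i j
  proof -
    have "inv (x i \<otimes> y i) \<otimes> (x j \<otimes> y j)
        = (inv (y i) \<otimes> g) \<otimes> (inv g \<otimes> (inv (x i) \<otimes> x j) \<otimes> inv (inv g)) \<otimes> (inv g \<otimes> y j)"
      using g xc yc by (simp add: group_norm)
    moreover have "inv (y i) \<otimes> g \<in> V" "inv g \<otimes> y j \<in> V"
      using P(2) that k g_def by auto
    moreover have "inv g \<otimes> (inv (x i) \<otimes> x j) \<otimes> inv (inv g) \<in> V"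
      using W(2) Q(2) that by auto
    ultimately show ?thesis using V(2) by simp
  qed
  then show "\<exists>P. eventually P F \<and> (\<forall>i j. P i \<longrightarrow> P j \<longrightarrow> inv (x i \<otimes> y i) \<otimes> (x j \<otimes> y j) \<in> U)"
    using eventually_conj[OF P(1) Q(1)] by blast
qed

lemma left_cauchy_cong:
  assumes "left_cauchy G B F x" "\<And>i. x i = y i"
  shows "left_cauchy G B F y"
proof -
  have "x = y" using assms(2) by blast
  then show ?thesis using assms(1) by simp
qed

lemma cauchy_nets_mult:
  assumes F: "F \<noteq> bot" and x: "x \<in> cauchy_nets G B F" and y: "y \<in> cauchy_nets G B F"
  shows "(\<lambda>i. x i \<otimes> y i) \<in> cauchy_nets G B F"
proof -
  have c: "\<And>i. x i \<in> carrier G" "\<And>i. y i \<in> carrier G"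
    using x y by (auto simp: cauchy_nets_def)
  have "left_cauchy G B F (\<lambda>i. inv (y i) \<otimes> inv (x i))"
    by (rule left_cauchy_mult[OF F]) (use x y c in \<open>auto simp: cauchy_nets_def\<close>)
  then have "left_cauchy G B F (\<lambda>i. inv (x i \<otimes> y i))"
    by (rule left_cauchy_cong) (simp add: c inv_mult_group)
  moreover have "left_cauchy G B F (\<lambda>i. x i \<otimes> y i)"
    by (rule left_cauchy_mult[OF F]) (use x y c in \<open>auto simp: cauchy_nets_def\<close>)
  ultimately show ?thesis using c by (simp add: cauchy_nets_def)
qed

lemma cauchy_nets_inv:
  assumes x: "x \<in> cauchy_nets G B F"
  shows "(\<lambda>i. inv (x i)) \<in> cauchy_nets G B F"
proof -
  have c: "\<And>i. x i \<in> carrier G" using x by (auto simp: cauchy_nets_def)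
  have "left_cauchy G B F (\<lambda>i. inv (inv (x i)))"
    by (rule left_cauchy_cong[of F x]) (use x c in \<open>auto simp: cauchy_nets_def\<close>)
  then show ?thesis using x c by (auto simp: cauchy_nets_def)
qed

lemma cauchy_nets_const:
  assumes "g \<in> carrier G"
  shows "(\<lambda>i. g) \<in> cauchy_nets G B F"
proof -
  have "left_cauchy G B F (\<lambda>i. h)" if "h \<in> carrier G" for h
    unfolding left_cauchy_def using that one_in by (auto intro!: exI[of _ "\<lambda>_. True"])
  then show ?thesis using assms by (auto simp: cauchy_nets_def)
qed

lemma net_group:
  assumes F: "F \<noteq> bot"
  shows "group (net_group G B F)"
    and "x \<in> cauchy_nets G B F \<Longrightarrow> inv\<^bsub>net_group G B F\<^esub> x = (\<lambda>i. inv (x i))"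
proof -
  have c: "x i \<in> carrier G" if "x \<in> cauchy_nets G B F" for x i
    using that by (auto simp: cauchy_nets_def)
  show g: "group (net_group G B F)"
  proof (rule groupI)
    fix x assume "x \<in> carrier (net_group G B F)"
    then show "\<exists>y\<in>carrier (net_group G B F). y \<otimes>\<^bsub>net_group G B F\<^esub> x = \<one>\<^bsub>net_group G B F\<^esub>"
      by (intro bexI[of _ "\<lambda>i. inv (x i)"]) (auto simp: net_group_def c cauchy_nets_inv)
  qed (auto simp: net_group_def cauchy_nets_mult[OF F] cauchy_nets_const c m_assoc)
  assume x: "x \<in> cauchy_nets G B F"
  show "inv\<^bsub>net_group G B F\<^esub> x = (\<lambda>i. inv (x i))"
    by (rule group.inv_equality[OF g]) (use x in \<open>auto simp: net_group_def c cauchy_nets_inv\<close>)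
qed

text \<open>
  Conjugation by a net is again controlled by conjugation with one of its values \<open>x\<^sub>k\<close>; here the
  right Cauchy property of \<open>x\<close> is what is used.
\<close>

lemma group_nhds_net:
  assumes F: "F \<noteq> bot"
  shows "group_nhds (net_group G B F) (net_nhds G B F)"
proof (intro group_nhds.intro group_nhds_axioms.intro net_group(1)[OF F])
  let ?N = "\<lambda>U. {x \<in> cauchy_nets G B F. eventually (\<lambda>i. x i \<in> U) F}"
  show "net_nhds G B F \<noteq> {}" using nonempty by (simp add: net_nhds_def)
  fix P assume "P \<in> net_nhds G B F"
  then obtain U where U: "U \<in> B" "P = ?N U" unfolding net_nhds_def by blast
  show "P \<subseteq> carrier (net_group G B F)" using U(2) by (auto simp: net_group_def)
  show "\<one>\<^bsub>net_group G B F\<^esub> \<in> P"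
    using U one_in cauchy_nets_const by (auto simp: net_group_def)
  {
    fix Q assume "Q \<in> net_nhds G B F"
    then obtain V where V: "V \<in> B" "Q = ?N V" unfolding net_nhds_def by blast
    obtain W where W: "W \<in> B" "W \<subseteq> U \<inter> V" using directed U(1) V(1) by blast
    have "?N W \<subseteq> P \<inter> Q" unfolding U(2) V(2) using W(2) by (auto elim!: eventually_mono)
    then show "\<exists>W\<in>net_nhds G B F. W \<subseteq> P \<inter> Q" using W(1) unfolding net_nhds_def by blast
  }
  obtain V where V: "V \<in> B" "\<forall>x\<in>V. \<forall>y\<in>V. x \<otimes> y \<in> U" using small_mult U(1) by blast
  have "x \<otimes>\<^bsub>net_group G B F\<^esub> y \<in> P" if "x \<in> ?N V" "y \<in> ?N V" for x y
  proof -
    have "eventually (\<lambda>i. x i \<in> V \<and> y i \<in> V) F" using that by (auto intro: eventually_conj)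
    then have "eventually (\<lambda>i. x i \<otimes> y i \<in> U) F" by (rule eventually_mono) (use V(2) in blast)
    then show ?thesis using that cauchy_nets_mult[OF F] by (auto simp: U(2) net_group_def)
  qed
  then show "\<exists>V\<in>net_nhds G B F. \<forall>x\<in>V. \<forall>y\<in>V. x \<otimes>\<^bsub>net_group G B F\<^esub> y \<in> P"
    using V(1) unfolding net_nhds_def by blast
  obtain V where V: "V \<in> B" "\<forall>x\<in>V. inv x \<in> U" using small_inv U(1) by blast
  have "inv\<^bsub>net_group G B F\<^esub> x \<in> P" if "x \<in> ?N V" for x
  proof -
    have "eventually (\<lambda>i. x i \<in> V) F" using that by simp
    then have "eventually (\<lambda>i. inv (x i) \<in> U) F" by (rule eventually_mono) (use V(2) in blast)
    then show ?thesis using that cauchy_nets_inv net_group(2)[OF F] by (auto simp: U(2))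
  qed
  then show "\<exists>V\<in>net_nhds G B F. \<forall>x\<in>V. inv\<^bsub>net_group G B F\<^esub> x \<in> P"
    using V(1) unfolding net_nhds_def by blast
  fix x assume "x \<in> carrier (net_group G B F)"
  then have x: "x \<in> cauchy_nets G B F" by (simp add: net_group_def)
  then have xc: "\<And>i. x i \<in> carrier G" by (auto simp: cauchy_nets_def)
  obtain V where V: "V \<in> B" "\<And>x. x \<in> V \<Longrightarrow> inv x \<in> U"
      "\<And>x y z. x \<in> V \<Longrightarrow> y \<in> V \<Longrightarrow> z \<in> V \<Longrightarrow> x \<otimes> y \<otimes> z \<in> U"
    using small[OF U(1)] by metis
  have "left_cauchy G B F (\<lambda>i. inv (x i))" using x by (auto simp: cauchy_nets_def)
  then obtain Q where Q: "eventually Q F"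
    "\<And>i j. Q i \<Longrightarrow> Q j \<Longrightarrow> inv (inv (x i)) \<otimes> inv (x j) \<in> V"
    using V(1) unfolding left_cauchy_def by meson
  obtain k where k: "Q k" using eventually_happens'[OF F Q(1)] by blast
  define h where "h = x k"
  have h: "h \<in> carrier G" using xc h_def by simp
  obtain W where W: "W \<in> B" "\<forall>w\<in>W. h \<otimes> w \<otimes> inv h \<in> V" using small_conj[OF h V(1)] by blast
  have "x \<otimes>\<^bsub>net_group G B F\<^esub> u \<otimes>\<^bsub>net_group G B F\<^esub> inv\<^bsub>net_group G B F\<^esub> x \<in> P" if u: "u \<in> ?N W" for u
  proof -
    have uc: "\<And>i. u i \<in> carrier G" using u by (auto simp: cauchy_nets_def)
    have "eventually (\<lambda>i. Q i \<and> u i \<in> W) F" using u Q(1) by (auto intro: eventually_conj)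
    then have "eventually (\<lambda>i. x i \<otimes> u i \<otimes> inv (x i) \<in> U) F"
    proof (rule eventually_mono)
      fix i assume i: "Q i \<and> u i \<in> W"
      have "x i \<otimes> u i \<otimes> inv (x i)
          = (inv (inv (x i)) \<otimes> inv h) \<otimes> (h \<otimes> u i \<otimes> inv h) \<otimes> (inv (inv h) \<otimes> inv (x i))"
        using xc uc h by (simp add: group_norm)
      then show "x i \<otimes> u i \<otimes> inv (x i) \<in> U"
        using V(3) W(2) Q(2) i k h_def by simp
    qed
    then show ?thesis
      using x u cauchy_nets_mult[OF F cauchy_nets_mult[OF F x, of u] cauchy_nets_inv[OF x]]
      by (simp add: U(2) net_group(2)[OF F x]) (simp add: net_group_def)
  qed
  then show "\<exists>V\<in>net_nhds G B F. \<forall>u\<in>V.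
      x \<otimes>\<^bsub>net_group G B F\<^esub> u \<otimes>\<^bsub>net_group G B F\<^esub> inv\<^bsub>net_group G B F\<^esub> x \<in> P"
    using W(1) unfolding net_nhds_def by blast
qed

end

text \<open>
  Let \<open>F\<close> be a Cauchy filter on \<open>A\<close>. Sending \<open>g\<close> to the constant net \<open>f g\<close> is a continuous
  homomorphism of \<open>G\<close> into the Hausdorff group of Cauchy nets along \<open>F\<close> modulo null nets. Its image
  is closed by \<open>h\<close>-completeness. The identity function is a Cauchy net along \<open>F\<close>, and it lies
  in the closure of the constant nets; so it agrees with a constant net modulo null nets, and this
  constant is a limit of \<open>F\<close>.
\<close>

theorem h_complete_imp_nhds_complete:
  fixes G :: "('a, 'm) monoid_scheme" and A :: "('b, 'n) monoid_scheme"
  assumes T: "topological_group G T" and hc: "h_complete G T"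
    and B: "group_nhds A B" and f: "f \<in> hom G A" and onto: "f ` carrier G = carrier A"
    and coarse: "\<And>U. U \<in> B \<Longrightarrow> \<exists>W. openin T W \<and> \<one>\<^bsub>G\<^esub> \<in> W \<and> f ` W \<subseteq> U"
  shows "nhds_complete A B"
  unfolding nhds_complete_def
proof (intro allI impI)
  fix F assume F: "F \<noteq> bot \<and> nhds_cauchy A B F"
  interpret A: group_nhds A B by (rule B)
  interpret gh: group_hom G A f
    by (intro group_hom.intro group_hom_axioms.intro topological_groupD(1)[OF T] A.is_group f)
  let ?L = "net_group A B F"
  let ?C = "net_nhds A B F"
  let ?N = "\<lambda>U. {x \<in> cauchy_nets A B F. eventually (\<lambda>i. x i \<in> U) F}"
  interpret L: group_nhds ?L ?C using A.group_nhds_net F by blast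
  interpret N: normal "\<Inter>?C" ?L by (rule L.normal_Inter)
  let ?q = "\<lambda>x. \<Inter>?C #>\<^bsub>?L\<^esub> x"
  let ?Q = "(\<lambda>U. ?q ` U) ` ?C"
  interpret Q: group_nhds "?L Mod \<Inter>?C" ?Q by (rule L.group_nhds_quotient)
  have carL: "carrier ?L = cauchy_nets A B F" by (simp add: net_group_def)
  define c where "c = (\<lambda>a::'b. (\<lambda>i::'b. a))"
  have cL: "c a \<in> carrier ?L" if "a \<in> carrier A" for a
    using that A.cauchy_nets_const by (simp add: c_def carL)
  have "(\<lambda>g. c (f g)) \<in> hom G ?L"
    using cL by (auto simp: hom_def) (auto simp: c_def net_group_def)
  then have hom: "?q \<circ> (\<lambda>g. c (f g)) \<in> hom G (?L Mod \<Inter>?C)"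
    using L.quotient_hom by (rule hom_compose)
  have "continuous_map T (nhds_topology (?L Mod \<Inter>?C) ?Q) (?q \<circ> (\<lambda>g. c (f g)))"
  proof (rule continuous_hom_nhds_topology[OF T Q.group_nhds_axioms hom])
    fix P assume "P \<in> ?Q"
    then obtain U where U: "U \<in> B" "P = ?q ` ?N U" unfolding net_nhds_def by blast
    obtain W where W: "openin T W" "\<one>\<^bsub>G\<^esub> \<in> W" "f ` W \<subseteq> U" using coarse[OF U(1)] by blast
    have "c (f g) \<in> ?N U" if "g \<in> W" for g
    proof -
      have "g \<in> carrier G"
        using that W(1) openin_subset topological_groupD(2)[OF T] by blast
      then show ?thesis using cL[of "f g"] W(3) that unfolding c_def carL by auto
    qed
    then show "\<exists>W. openin T W \<and> \<one>\<^bsub>G\<^esub> \<in> W \<and> (?q \<circ> (\<lambda>g. c (f g))) ` W \<subseteq> P"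
      using W U(2) by (intro exI[of _ W]) auto
  qed
  then have closed: "closedin (nhds_topology (?L Mod \<Inter>?C) ?Q)
      ((?q \<circ> (\<lambda>g. c (f g))) ` carrier G)"
    using h_complete_closed_image[OF topological_groupD(1,2)[OF T] hc
        L.topological_group_quotient hom] by blast
  (* the identity net; only its values on the carrier matter, since F is concentrated there *)
  define e where "e = (\<lambda>i. if i \<in> carrier A then i else \<one>\<^bsub>A\<^esub>)"
  have Fc: "\<exists>P. eventually P F \<and> (\<forall>i j. P i \<longrightarrow> P j \<longrightarrow> i \<in> carrier A \<and> j \<in> carrier A \<and>
      inv\<^bsub>A\<^esub> i \<otimes>\<^bsub>A\<^esub> j \<in> U \<and> i \<otimes>\<^bsub>A\<^esub> inv\<^bsub>A\<^esub> j \<in> U)" if U: "U \<in> B" for U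
  proof -
    obtain X where "eventually (\<lambda>x. x \<in> X) F" "X \<subseteq> carrier A"
      "\<forall>x\<in>X. \<forall>y\<in>X. inv\<^bsub>A\<^esub> x \<otimes>\<^bsub>A\<^esub> y \<in> U \<and> x \<otimes>\<^bsub>A\<^esub> inv\<^bsub>A\<^esub> y \<in> U"
      using F U unfolding nhds_cauchy_def by meson
    then show ?thesis by (intro exI[of _ "\<lambda>x. x \<in> X"]) blast
  qed
  have "left_cauchy A B F e" "left_cauchy A B F (\<lambda>i. inv\<^bsub>A\<^esub> (e i))"
    unfolding left_cauchy_def
  proof (safe)
    fix U assume U: "U \<in> B"
    obtain P where P: "eventually P F" "\<And>i j. P i \<Longrightarrow> P j \<Longrightarrow> i \<in> carrier A \<and> j \<in> carrier A \<and>
      inv\<^bsub>A\<^esub> i \<otimes>\<^bsub>A\<^esub> j \<in> U \<and> i \<otimes>\<^bsub>A\<^esub> inv\<^bsub>A\<^esub> j \<in> U" using Fc[OF U] by meson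
    then show "\<exists>P. eventually P F \<and> (\<forall>i j. P i \<longrightarrow> P j \<longrightarrow> inv\<^bsub>A\<^esub> e i \<otimes>\<^bsub>A\<^esub> e j \<in> U)"
      "\<exists>P. eventually P F \<and> (\<forall>i j. P i \<longrightarrow> P j \<longrightarrow> inv\<^bsub>A\<^esub> (inv\<^bsub>A\<^esub> e i) \<otimes>\<^bsub>A\<^esub> inv\<^bsub>A\<^esub> e j \<in> U)"
      by (auto intro!: exI[of _ P] simp: e_def)
  qed
  then have e: "e \<in> carrier ?L" by (auto simp: carL cauchy_nets_def e_def)
  have "\<exists>g\<in>carrier G. ?q (c (f g)) = ?q e"
  proof (rule ccontr)
    assume no: "\<not> ?thesis"
    let ?I = "(?q \<circ> (\<lambda>g. c (f g))) ` carrier G"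
    have qe: "?q e \<in> carrier (?L Mod \<Inter>?C)" using e by (auto simp: carrier_FactGroup)
    have "openin (nhds_topology (?L Mod \<Inter>?C) ?Q) (carrier (?L Mod \<Inter>?C) - ?I)"
      using closed unfolding closedin_def Q.topspace_nhds_topology by blast
    moreover have "?q e \<in> carrier (?L Mod \<Inter>?C) - ?I" using qe no by auto
    ultimately have "\<exists>P\<in>?Q. \<forall>p\<in>P. ?q e \<otimes>\<^bsub>?L Mod \<Inter>?C\<^esub> p \<in> carrier (?L Mod \<Inter>?C) - ?I"
      unfolding Q.openin_nhds_topology by blast
    then obtain U where U: "U \<in> B"
      "\<And>u. u \<in> ?N U \<Longrightarrow> ?q e \<otimes>\<^bsub>?L Mod \<Inter>?C\<^esub> ?q u \<notin> ?I"
      unfolding net_nhds_def by blast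
    obtain P where P: "eventually P F" "\<And>i j. P i \<Longrightarrow> P j \<Longrightarrow> i \<in> carrier A \<and> j \<in> carrier A \<and>
      inv\<^bsub>A\<^esub> i \<otimes>\<^bsub>A\<^esub> j \<in> U \<and> i \<otimes>\<^bsub>A\<^esub> inv\<^bsub>A\<^esub> j \<in> U" using Fc[OF U(1)] by meson
    obtain k where k: "P k" using eventually_happens' F P(1) by blast
    then have kA: "k \<in> carrier A" using P(2) by blast
    then obtain g where g: "g \<in> carrier G" "f g = k" using onto by (metis imageE)
    (* k is a value of the net e so far out that the constant net k is U-close to e *)
    define u where "u = inv\<^bsub>?L\<^esub> e \<otimes>\<^bsub>?L\<^esub> c k"
    have uL: "u \<in> carrier ?L" using e cL[OF kA] by (simp add: u_def)
    have ui: "u i = inv\<^bsub>A\<^esub> (e i) \<otimes>\<^bsub>A\<^esub> k" for i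
      using A.net_group(2)[of F e] F e unfolding u_def carL
      by (simp add: c_def) (simp add: net_group_def)
    have "eventually (\<lambda>i. u i \<in> U) F"
      using P(1) by (rule eventually_mono) (use P(2) k in \<open>auto simp: ui e_def\<close>)
    then have "u \<in> ?N U" using uL carL by simp
    moreover have "?q e \<otimes>\<^bsub>?L Mod \<Inter>?C\<^esub> ?q u = ?q (c k)"
      using e uL cL[OF kA] by (simp add: N.rcos_sum u_def L.group_norm)
    ultimately have "?q (c k) \<notin> ?I" using U(2)[of u] by metis
    moreover have "?q (c k) \<in> ?I" using imageI[OF g(1), of "?q \<circ> (\<lambda>g. c (f g))"] g(2) by simp
    ultimately show False by contradiction
  qed
  then obtain g where g: "g \<in> carrier G" "?q (c (f g)) = ?q e" by blast
  define z where "z = f g"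
  have z: "z \<in> carrier A" using g z_def by simp
  have "e \<in> ?q (c z)"
    using g L.rcos_self[OF e N.is_subgroup] by (simp add: z_def)
  then obtain n where n: "n \<in> \<Inter>?C" "e = n \<otimes>\<^bsub>?L\<^esub> c z" unfolding r_coset_def by blast
  have nL: "n \<in> carrier ?L" using n(1) N.subset by blast
  have "inv\<^bsub>?L\<^esub> (c z) \<otimes>\<^bsub>?L\<^esub> n \<otimes>\<^bsub>?L\<^esub> inv\<^bsub>?L\<^esub> (inv\<^bsub>?L\<^esub> (c z)) \<in> \<Inter>?C"
    using n(1) cL[OF z] L.normal_inv_iff N.normal_axioms by blast
  then have m: "inv\<^bsub>?L\<^esub> (c z) \<otimes>\<^bsub>?L\<^esub> e \<in> \<Inter>?C"
    using n(2) cL[OF z] nL by (simp add: L.m_assoc)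
  have "nhds_limit A B F z"
    unfolding nhds_limit_def
  proof (intro conjI ballI z)
    fix U assume U: "U \<in> B"
    then have "inv\<^bsub>?L\<^esub> (c z) \<otimes>\<^bsub>?L\<^esub> e \<in> ?N U" using m unfolding net_nhds_def by blast
    moreover have "inv\<^bsub>?L\<^esub> (c z) \<otimes>\<^bsub>?L\<^esub> e = (\<lambda>i. inv\<^bsub>A\<^esub> z \<otimes>\<^bsub>A\<^esub> e i)"
      using A.net_group(2)[of F "c z"] F cL[OF z] unfolding carL
      by (simp add: c_def) (simp add: net_group_def)
    ultimately have ev: "eventually (\<lambda>i. inv\<^bsub>A\<^esub> z \<otimes>\<^bsub>A\<^esub> e i \<in> U) F" by simp
    obtain P where P: "eventually P F" "\<And>i j. P i \<Longrightarrow> P j \<Longrightarrow> i \<in> carrier A \<and> j \<in> carrier A \<and>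
      inv\<^bsub>A\<^esub> i \<otimes>\<^bsub>A\<^esub> j \<in> U \<and> i \<otimes>\<^bsub>A\<^esub> inv\<^bsub>A\<^esub> j \<in> U" using Fc[OF U] by meson
    show "eventually (\<lambda>i. inv\<^bsub>A\<^esub> z \<otimes>\<^bsub>A\<^esub> i \<in> U) F"
      using eventually_conj[OF ev P(1)]
      by (rule eventually_mono) (use P(2) in \<open>auto simp: e_def split: if_splits\<close>)
  qed
  then show "\<exists>z. nhds_limit A B F z" by blast
qed

section \<open>An open mapping theorem\<close>

text \<open>
  A countable base, normalised so that each step in the index leaves room for a product of three
  elements, the length of a conjugate by a small element.
\<close>

locale nhds_seq = group_nhds G "range V" for G (structure) and V :: "nat \<Rightarrow> 'a set" +
  assumes triple: "x \<in> V (Suc n) \<Longrightarrow> y \<in> V (Suc n) \<Longrightarrow> z \<in> V (Suc n) \<Longrightarrow> x \<otimes> y \<otimes> z \<in> V n"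
    and inv_step: "x \<in> V (Suc n) \<Longrightarrow> inv x \<in> V n"
begin

lemma seq_carrier: "x \<in> V n \<Longrightarrow> x \<in> carrier G"
  using sub by blast

lemma seq_one: "\<one> \<in> V n"
  using one_in by blast

lemma mult_step: "x \<in> V (Suc n) \<Longrightarrow> y \<in> V (Suc n) \<Longrightarrow> x \<otimes> y \<in> V n"
  using triple[of x n y \<one>] seq_one seq_carrier by simp

lemma decreasing: "n \<le> m \<Longrightarrow> V m \<subseteq> V n"
proof (induction rule: dec_induct)
  case (step m)
  have "V (Suc m) \<subseteq> V m"
    using mult_step[of _ m \<one>] seq_one seq_carrier by fastforce
  then show ?case using step by blast
qed simp

lemma decreasingD: "x \<in> V m \<Longrightarrow> n \<le> m \<Longrightarrow> x \<in> V n"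
  using decreasing by blast

lemma conj_seq:
  assumes "g \<in> carrier G"
  obtains m where "\<And>x. x \<in> V m \<Longrightarrow> g \<otimes> x \<otimes> inv g \<in> V n"
  using small_conj[OF assms, of "V n"] by auto

text \<open>
  The sets \<open>x\<^sub>n V\<^bsub>k n\<^esub>\<close> are nested, which makes \<open>x\<close> left Cauchy. It is right Cauchy because \<open>k n\<close>
  is chosen in view of \<open>x\<^sub>n\<close>: conjugation by \<open>x\<^sub>n\<close> keeps \<open>V\<^bsub>k n\<^esub>\<close> small. The steps are taken in
  \<open>V\<^bsub>k n + 1\<^esub>\<close> to leave room for the limit inside all the sets.
\<close>

lemma chain_converges:
  assumes complete: "nhds_complete G (range V)"
    and x: "\<And>n. x n \<in> carrier G"
    and step: "\<And>n. inv (x n) \<otimes> x (Suc n) \<in> V (Suc (k n))" "\<And>n. k n < k (Suc n)"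
    and conj: "\<And>n u. u \<in> V (k n) \<Longrightarrow> x n \<otimes> u \<otimes> inv (x n) \<in> V n"
  obtains z where "z \<in> carrier G" "\<And>l. eventually (\<lambda>n. inv z \<otimes> x n \<in> V l) sequentially"
    "\<And>n. inv (x n) \<otimes> z \<in> V (k n)"
proof -
  have kn: "n \<le> k n" for n
    using step(2) by (induction n) (auto intro: less_le_trans le_less_trans Suc_leI)
  have nested: "inv (x n) \<otimes> x (n + r) \<in> V (k n)" for n r
  proof (induction r arbitrary: n)
    case 0 then show ?case using x seq_one by simp
  next
    case (Suc r)
    have "inv (x (Suc n)) \<otimes> x (Suc n + r) \<in> V (Suc (k n))"
      using Suc[of "Suc n"] step(2)[of n] decreasingD by (meson Suc_leI)
    then have "(inv (x n) \<otimes> x (Suc n)) \<otimes> (inv (x (Suc n)) \<otimes> x (Suc n + r)) \<in> V (k n)"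
      using step(1) mult_step by blast
    then show ?case using x by (simp add: group_norm)
  qed
  have nested': "inv (x n) \<otimes> x m \<in> V (k n)" if "n \<le> m" for n m
    using nested[of n "m - n"] that by simp
  have "nhds_cauchy G (range V) (filtermap x sequentially)"
    unfolding nhds_cauchy_def
  proof
    fix U assume "U \<in> range V"
    then obtain l where l: "U = V l" by blast
    define n where "n = Suc (Suc l)"
    have "inv (x i) \<otimes> x j \<in> U \<and> x i \<otimes> inv (x j) \<in> U" if ij: "n \<le> i" "n \<le> j" for i j
    proof
      define a b where "a = inv (x n) \<otimes> x i" and "b = inv (x n) \<otimes> x j"
      have ab: "a \<in> V (k n)" "b \<in> V (k n)" "a \<in> carrier G" "b \<in> carrier G"
        using nested' ij x by (auto simp: a_def b_def)
      then have "a \<in> V n" "b \<in> V n" using kn decreasingD by blast+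
      then have "inv a \<in> V (Suc l)" "b \<in> V (Suc l)"
        using inv_step decreasingD[of b n "Suc l"] by (auto simp: n_def)
      then have "inv a \<otimes> b \<in> U" unfolding l by (rule mult_step)
      then show "inv (x i) \<otimes> x j \<in> U" using x by (simp add: a_def b_def group_norm)
      have "x n \<otimes> a \<otimes> inv (x n) \<in> V n" "x n \<otimes> b \<otimes> inv (x n) \<in> V n"
        using conj ab by blast+
      then have "x n \<otimes> a \<otimes> inv (x n) \<in> V (Suc l)" "inv (x n \<otimes> b \<otimes> inv (x n)) \<in> V (Suc l)"
        using inv_step decreasingD[of _ n "Suc l"] by (auto simp: n_def)
      then have "(x n \<otimes> a \<otimes> inv (x n)) \<otimes> inv (x n \<otimes> b \<otimes> inv (x n)) \<in> U"
        unfolding l by (rule mult_step)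
      then show "x i \<otimes> inv (x j) \<in> U" using x by (simp add: a_def b_def group_norm)
    qed
    then show "\<exists>A. eventually (\<lambda>x. x \<in> A) (filtermap x sequentially) \<and> A \<subseteq> carrier G \<and>
        (\<forall>x\<in>A. \<forall>y\<in>A. inv x \<otimes> y \<in> U \<and> x \<otimes> inv y \<in> U)"
      using x by (intro exI[of _ "x ` {n..}"])
        (auto simp: eventually_filtermap eventually_sequentially)
  qed
  then obtain z where z: "nhds_limit G (range V) (filtermap x sequentially) z"
    using complete unfolding nhds_complete_def by (metis filtermap_bot_iff sequentially_bot)
  then have zc: "z \<in> carrier G" by (simp add: nhds_limit_def)
  have lim: "eventually (\<lambda>n. inv z \<otimes> x n \<in> V l) sequentially" for l
    using z by (auto simp: nhds_limit_def eventually_filtermap)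
  have "inv (x n) \<otimes> z \<in> V (k n)" for n
  proof -
    obtain m where m: "Suc n \<le> m" "inv z \<otimes> x m \<in> V (Suc (Suc (k n)))"
      using lim[of "Suc (Suc (k n))"] unfolding eventually_sequentially by (meson nat_le_linear)
    have "inv (inv z \<otimes> x m) \<in> V (Suc (k n))" using m(2) by (rule inv_step)
    moreover have "inv (x (Suc n)) \<otimes> x m \<in> V (Suc (k n))"
      using nested'[OF m(1)] step(2)[of n] decreasingD by (meson Suc_leI)
    ultimately have "(inv (x n) \<otimes> x (Suc n)) \<otimes> (inv (x (Suc n)) \<otimes> x m) \<otimes> inv (inv z \<otimes> x m) \<in> V (k n)"
      using step(1) triple by blast
    then show ?thesis using x zc by (simp add: group_norm)
  qed
  then show thesis using that zc lim by blast
qed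

end

text \<open>
  The setting of an open mapping theorem for the identity map from the finer topology (of \<open>W\<close>) to
  the coarser one (of \<open>V\<close>). Modulo the closures of the identity, both are Polish groups.
\<close>

locale nhds_seq_pair = S: nhds_seq G V + T: nhds_seq G W for G (structure) and V W +
  fixes D
  assumes finer: "W n \<subseteq> V n"
    and complete_S: "nhds_complete G (range V)" and complete_T: "nhds_complete G (range W)"
    and D: "countable D" "D \<subseteq> carrier G"
    and dense: "g \<in> carrier G \<Longrightarrow> \<exists>d\<in>D. inv d \<otimes> g \<in> W n"
begin

text \<open>
  The argument of Baire. Countably many translates \<open>d W'\<close> cover the group. If the \<open>V\<close>-closure of
  \<open>W n\<close> contained no \<open>V\<close>-neighbourhood of the identity, then the \<open>V\<close>-closures of these translates
  would have empty interior, and a sequence of shrinking neighbourhoods that avoid one of the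
  translates after the other would converge to a point outside all of them.
\<close>

lemma almost_open: "\<exists>m. \<forall>v\<in>V m. \<forall>l. \<exists>w\<in>W n. inv v \<otimes> w \<in> V l"
proof (rule ccontr)
  assume "\<not> ?thesis"
  then have no: "\<exists>v\<in>V m. \<exists>l. \<forall>w\<in>W n. inv v \<otimes> w \<notin> V l" for m by blast
  (* two steps of room: quotients of elements of W' lie in W n *)
  define W' where "W' = W (Suc (Suc n))"
  (* if x V(m) were inside the closure of d W', then V(m) would be inside that of W'^-1 W' *)
  have nowhere: "\<exists>v\<in>V m. \<exists>l. \<forall>w\<in>W'. inv (x \<otimes> v) \<otimes> (d \<otimes> w) \<notin> V l"
    if x: "x \<in> carrier G" and d: "d \<in> carrier G" for x d m
  proof (rule ccontr)
    assume "\<not> ?thesis"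
    then have cl: "\<exists>w\<in>W'. inv (x \<otimes> v) \<otimes> (d \<otimes> w) \<in> V l" if "v \<in> V m" for v l
      using that by blast
    obtain v l where v: "v \<in> V m" "\<forall>w\<in>W n. inv v \<otimes> w \<notin> V l" using no by blast
    have vc: "v \<in> carrier G" using v S.seq_carrier by blast
    obtain l' where l': "\<And>u. u \<in> V l' \<Longrightarrow> inv v \<otimes> u \<otimes> inv (inv v) \<in> V (Suc (Suc l))"
      using S.conj_seq[of "inv v"] vc by blast
    obtain w1 where w1: "w1 \<in> W'" "inv (x \<otimes> \<one>) \<otimes> (d \<otimes> w1) \<in> V l'" using cl S.seq_one by blast
    obtain w2 where w2: "w2 \<in> W'" "inv (x \<otimes> v) \<otimes> (d \<otimes> w2) \<in> V (Suc l)" using cl v by blast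
    have wc: "w1 \<in> carrier G" "w2 \<in> carrier G" using w1 w2 T.seq_carrier W'_def by auto
    have "inv (inv v \<otimes> (inv (x \<otimes> \<one>) \<otimes> (d \<otimes> w1)) \<otimes> inv (inv v)) \<in> V (Suc l)"
      using l' w1(2) S.inv_step by blast
    then have "inv (inv v \<otimes> (inv (x \<otimes> \<one>) \<otimes> (d \<otimes> w1)) \<otimes> inv (inv v)) \<otimes> (inv (x \<otimes> v) \<otimes> (d \<otimes> w2)) \<in> V l"
      using w2(2) by (rule S.mult_step)
    then have "inv v \<otimes> (inv w1 \<otimes> w2) \<in> V l"
      using x d vc wc by (simp add: S.group_norm)
    moreover have "inv w1 \<otimes> w2 \<in> W n"
      using w1(1) w2(1) T.inv_step T.decreasingD[of w2 "Suc (Suc n)" "Suc n"]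
      by (intro T.mult_step) (auto simp: W'_def)
    ultimately show False using v(2) by blast
  qed
  have "D \<noteq> {}" using dense[of \<one>] by blast
  define d where "d = from_nat_into D"
  have d: "d i \<in> carrier G" for i using D \<open>D \<noteq> {}\<close> by (simp add: d_def from_nat_into subset_iff)
  (* s n consists of a point and the index of a neighbourhood, as required by chain_converges *)
  have "\<exists>s. \<forall>n. (fst (s n) \<in> carrier G \<and> (\<forall>u\<in>V (snd (s n)). fst (s n) \<otimes> u \<otimes> inv (fst (s n)) \<in> V n)) \<and>
     (inv (fst (s n)) \<otimes> fst (s (Suc n)) \<in> V (Suc (snd (s n))) \<and> snd (s n) < snd (s (Suc n)) \<and>
      (\<forall>w\<in>W'. inv (fst (s (Suc n))) \<otimes> (d n \<otimes> w) \<notin> V (snd (s (Suc n)))))"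
  proof (rule dependent_nat_choice)
    show "\<exists>s. fst s \<in> carrier G \<and> (\<forall>u\<in>V (snd s). fst s \<otimes> u \<otimes> inv (fst s) \<in> V 0)"
      using S.seq_carrier by (intro exI[of _ "(\<one>, 0)"]) auto
  next
    fix s n assume s: "fst s \<in> carrier G \<and> (\<forall>u\<in>V (snd s). fst s \<otimes> u \<otimes> inv (fst s) \<in> V n)"
    obtain x k where xk: "s = (x, k)" by fastforce
    have x: "x \<in> carrier G" using s xk by simp
    obtain v l where v: "v \<in> V (Suc k)" "\<forall>w\<in>W'. inv (x \<otimes> v) \<otimes> (d n \<otimes> w) \<notin> V l"
      using nowhere[OF x d] by blast
    have vc: "v \<in> carrier G" using v S.seq_carrier by blast
    obtain j where j: "\<And>u. u \<in> V j \<Longrightarrow> (x \<otimes> v) \<otimes> u \<otimes> inv (x \<otimes> v) \<in> V (Suc n)"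
      using S.conj_seq[of "x \<otimes> v"] x vc by blast
    define k' where "k' = max l (max (Suc k) j)"
    have k': "l \<le> k'" "Suc k \<le> k'" "j \<le> k'" by (auto simp: k'_def)
    have "inv x \<otimes> (x \<otimes> v) = v" using x vc by (simp add: S.group_norm)
    then show "\<exists>s'. (fst s' \<in> carrier G \<and> (\<forall>u\<in>V (snd s'). fst s' \<otimes> u \<otimes> inv (fst s') \<in> V (Suc n))) \<and>
      (inv (fst s) \<otimes> fst s' \<in> V (Suc (snd s)) \<and> snd s < snd s' \<and>
      (\<forall>w\<in>W'. inv (fst s') \<otimes> (d n \<otimes> w) \<notin> V (snd s')))"
      using x vc v j k' S.decreasing[of l k'] S.decreasing[of j k']
      by (intro exI[of _ "(x \<otimes> v, k')"]) (auto simp: xk)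
  qed
  then obtain s where s: "\<And>n. fst (s n) \<in> carrier G"
    "\<And>n u. u\<in>V (snd (s n)) \<Longrightarrow> fst (s n) \<otimes> u \<otimes> inv (fst (s n)) \<in> V n"
    "\<And>n. inv (fst (s n)) \<otimes> fst (s (Suc n)) \<in> V (Suc (snd (s n)))"
    "\<And>n. snd (s n) < snd (s (Suc n))"
    "\<And>n w. w\<in>W' \<Longrightarrow> inv (fst (s (Suc n))) \<otimes> (d n \<otimes> w) \<notin> V (snd (s (Suc n)))" by meson
  obtain z where z: "z \<in> carrier G" "\<And>n. inv (fst (s n)) \<otimes> z \<in> V (snd (s n))"
    using S.chain_converges[OF complete_S, of "\<lambda>n. fst (s n)" "\<lambda>n. snd (s n)"] s by metis
  obtain e where e: "e \<in> D" "inv e \<otimes> z \<in> W'" using dense[OF z(1)] W'_def by blast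
  then obtain i where i: "e = d i"
    unfolding d_def using from_nat_into_surj[OF D(1)] by metis
  have "d i \<otimes> (inv e \<otimes> z) = z" using d z(1) i by (simp add: S.group_norm)
  then show False using s(5)[OF e(2), of i] z(2)[of "Suc i"] by simp
qed

text \<open>
  Moving \<open>q\<close> to \<open>q w\<close> inside \<open>q W\<^bsub>j + 1\<^esub>\<close> brings it close enough to \<open>p v\<close> for almost openness to
  apply at \<open>p\<close>, so that afterwards \<open>p\<close> can be moved towards \<open>q w v\<inverse>\<close> in the same way.
\<close>

lemma half_step:
  assumes p: "p \<in> carrier G" and q: "q \<in> carrier G" and v: "v \<in> carrier G"
    and cl: "\<forall>l. \<exists>w\<in>W (Suc j). inv (p \<otimes> v) \<otimes> (q \<otimes> w) \<in> V l"
  shows "\<exists>w\<in>W (Suc j). inv (p \<otimes> v) \<otimes> (q \<otimes> w) \<in> V n \<and>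
    (\<forall>l. \<exists>u\<in>W (Suc k). inv (q \<otimes> w \<otimes> inv v) \<otimes> (p \<otimes> u) \<in> V l)"
proof -
  obtain m where m: "\<forall>y\<in>V m. \<forall>l. \<exists>u\<in>W (Suc k). inv y \<otimes> u \<in> V l" using almost_open by blast
  obtain t where t: "\<And>x. x \<in> V t \<Longrightarrow> v \<otimes> x \<otimes> inv v \<in> V m" using S.conj_seq[OF v] by blast
  obtain w where w: "w \<in> W (Suc j)" "inv (p \<otimes> v) \<otimes> (q \<otimes> w) \<in> V (max n t)" using cl by blast
  have wc: "w \<in> carrier G" using w T.seq_carrier by blast
  define y where "y = v \<otimes> (inv (p \<otimes> v) \<otimes> (q \<otimes> w)) \<otimes> inv v"
  have y: "y \<in> V m" using t S.decreasingD[OF w(2), of t] by (simp add: y_def)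
  have "\<exists>u\<in>W (Suc k). inv (q \<otimes> w \<otimes> inv v) \<otimes> (p \<otimes> u) \<in> V l" for l
  proof -
    obtain u where u: "u \<in> W (Suc k)" "inv y \<otimes> u \<in> V l" using m y by blast
    have "u \<in> carrier G" using u T.seq_carrier by blast
    then have "inv (q \<otimes> w \<otimes> inv v) \<otimes> (p \<otimes> u) = inv y \<otimes> u"
      using p q v wc by (simp add: y_def S.group_norm)
    then show ?thesis using u by (intro bexI[of _ u]) simp_all
  qed
  then show ?thesis using w S.decreasingD[OF w(2), of n] by auto
qed

text \<open>
  The classical proof writes \<open>v\<close> as an infinite product \<open>w\<^sub>0 w\<^sub>1 w\<^sub>2 \<dots>\<close> of ever smaller corrections.
  The partial products are only left Cauchy, because each correction must be restricted before the
  previous one is known. Here two sequences \<open>p\<close> and \<open>q\<close> are moved in turn, such that \<open>p\<^sub>n v\<close> and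
  \<open>q\<^sub>n\<close> approach each other for \<open>V\<close>. As no fixed target has to be met, the neighbourhood in which
  \<open>p\<^sub>n\<close> may still move is chosen after \<open>p\<^sub>n\<close>, and likewise for \<open>q\<close>. So both converge for \<open>W\<close>, to \<open>y\<close>
  and \<open>z\<close>, say; then \<open>y v\<close> and \<open>z\<close> agree modulo \<open>\<Inter>(range V)\<close>, and \<open>y\<inverse> z\<close> is the required
  element of \<open>W n\<close>.
\<close>

theorem open_mapping: "\<exists>m. \<forall>v\<in>V m. \<exists>w\<in>W n. inv w \<otimes> v \<in> \<Inter>(range V)"
proof -
  (* p and q stay in W k0, and quotients of elements of W k0 lie in W n *)
  define k0 where "k0 = Suc (Suc n)"
  obtain m where m: "\<forall>v\<in>V m. \<forall>l. \<exists>w\<in>W (Suc k0). inv v \<otimes> w \<in> V l" using almost_open by blast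
  have "\<exists>w\<in>W n. inv w \<otimes> v \<in> \<Inter>(range V)" if v: "v \<in> V m" for v
  proof -
    have vc: "v \<in> carrier G" using v S.seq_carrier by blast
    (* p and q move within p W(k) and q W(j) from now on; the last condition allows the next move *)
    define P where "P = (\<lambda>n (p, k, q, j). p \<in> carrier G \<and> q \<in> carrier G \<and>
      (\<forall>u\<in>W k. p \<otimes> u \<otimes> inv p \<in> W n) \<and> (\<forall>u\<in>W j. q \<otimes> u \<otimes> inv q \<in> W n) \<and>
      (\<forall>l. \<exists>w\<in>W (Suc j). inv (p \<otimes> v) \<otimes> (q \<otimes> w) \<in> V l))"
    define Q where "Q = (\<lambda>n (p, k, q, j) (p', k', q', j'). 
      inv p \<otimes> p' \<in> W (Suc k) \<and> k < k' \<and> inv q \<otimes> q' \<in> W (Suc j) \<and> j < j' \<and>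
      inv (p \<otimes> v) \<otimes> q' \<in> V n)"
    have "\<exists>s. \<forall>n. (P n (s n) \<and> (n = 0 \<longrightarrow> s n = (\<one>, k0, \<one>, k0))) \<and> Q n (s n) (s (Suc n))"
    proof (rule dependent_nat_choice)
      show "\<exists>x. P 0 x \<and> (0 = 0 \<longrightarrow> x = (\<one>, k0, \<one>, k0))"
      proof (intro exI conjI impI)
        have "\<exists>w\<in>W (Suc k0). inv (\<one> \<otimes> v) \<otimes> (\<one> \<otimes> w) \<in> V l" for l
        proof -
          obtain w where "w \<in> W (Suc k0)" "inv v \<otimes> w \<in> V l" using m v by blast
          then show ?thesis using vc T.seq_carrier by (intro bexI[of _ w]) auto
        qed
        then show "P 0 (\<one>, k0, \<one>, k0)"
          using T.seq_carrier T.decreasingD[of _ k0 0] by (auto simp: P_def)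
      qed simp
    next
      fix s i assume s: "P i s \<and> (i = 0 \<longrightarrow> s = (\<one>, k0, \<one>, k0))"
      obtain p k q j where e: "s = (p, k, q, j)" by (cases s)
      have c: "p \<in> carrier G" "q \<in> carrier G" and
        cl: "\<forall>l. \<exists>w\<in>W (Suc j). inv (p \<otimes> v) \<otimes> (q \<otimes> w) \<in> V l"
        using s by (auto simp: P_def e)
      obtain w where w: "w \<in> W (Suc j)" "inv (p \<otimes> v) \<otimes> (q \<otimes> w) \<in> V i"
        "\<forall>l. \<exists>u\<in>W (Suc k). inv (q \<otimes> w \<otimes> inv v) \<otimes> (p \<otimes> u) \<in> V l"
        using half_step[OF c vc cl] by blast
      have wc: "w \<in> carrier G" using w T.seq_carrier by blast
      define q' where "q' = q \<otimes> w"
      have q': "q' \<in> carrier G" using c wc by (simp add: q'_def)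
      obtain j1 where j1: "\<And>u. u \<in> W j1 \<Longrightarrow> q' \<otimes> u \<otimes> inv q' \<in> W (Suc i)"
        using T.conj_seq[OF q'] by blast
      define j' where "j' = max j1 (Suc j)"
      obtain u where u: "u \<in> W (Suc k)"
        "\<forall>l. \<exists>w\<in>W (Suc j'). inv (p \<otimes> u \<otimes> inv (inv v)) \<otimes> (q' \<otimes> w) \<in> V l"
        using half_step[OF q' c(1) S.inv_closed[OF vc], of k _ j'] w(3)
        unfolding q'_def[symmetric] by blast
      have uc: "u \<in> carrier G" using u T.seq_carrier by blast
      define p' where "p' = p \<otimes> u"
      have p': "p' \<in> carrier G" using c uc by (simp add: p'_def)
      obtain k1 where k1: "\<And>u. u \<in> W k1 \<Longrightarrow> p' \<otimes> u \<otimes> inv p' \<in> W (Suc i)"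
        using T.conj_seq[OF p'] by blast
      define k' where "k' = max k1 (Suc k)"
      have "P (Suc i) (p', k', q', j')"
        using p' q' j1 k1 u(2) vc T.decreasingD[of _ k' k1] T.decreasingD[of _ j' j1]
        unfolding P_def by (auto simp: p'_def k'_def j'_def)
      moreover have "inv p \<otimes> p' = u" "inv q \<otimes> q' = w"
        using c uc wc by (simp_all add: p'_def q'_def S.group_norm)
      then have "Q i s (p', k', q', j')"
        using u(1) w(1,2) by (simp add: Q_def e k'_def j'_def q'_def less_max_iff_disj)
      ultimately show "\<exists>s'. (P (Suc i) s' \<and> (Suc i = 0 \<longrightarrow> s' = (\<one>, k0, \<one>, k0))) \<and> Q i s s'"
        by blast
    qed
    then obtain s where s: "\<And>i. P i (s i)" "s 0 = (\<one>, k0, \<one>, k0)" "\<And>i. Q i (s i) (s (Suc i))"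
      by metis
    define p k q j where "p = (\<lambda>i. fst (s i))" and "k = (\<lambda>i. fst (snd (s i)))"
      and "q = (\<lambda>i. fst (snd (snd (s i))))" and "j = (\<lambda>i. snd (snd (snd (s i))))"
    have e: "s i = (p i, k i, q i, j i)" for i by (simp add: p_def k_def q_def j_def)
    have pq: "p i \<in> carrier G" "q i \<in> carrier G" for i
      using s(1)[of i] by (auto simp: P_def e)
    have conj: "u \<in> W (k i) \<Longrightarrow> p i \<otimes> u \<otimes> inv (p i) \<in> W i"
      "u \<in> W (j i) \<Longrightarrow> q i \<otimes> u \<otimes> inv (q i) \<in> W i" for i u
      using s(1)[of i] by (auto simp: P_def e)
    have step: "inv (p i) \<otimes> p (Suc i) \<in> W (Suc (k i))" "k i < k (Suc i)"
      "inv (q i) \<otimes> q (Suc i) \<in> W (Suc (j i))" "j i < j (Suc i)"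
      "inv (p i \<otimes> v) \<otimes> q (Suc i) \<in> V i" for i
      using s(3)[of i] by (auto simp: Q_def e)
    have start: "p 0 = \<one>" "q 0 = \<one>" "k 0 = k0" "j 0 = k0"
      using s(2) by (auto simp: e)
    obtain y where y: "y \<in> carrier G" "\<And>l. eventually (\<lambda>n. inv y \<otimes> p n \<in> W l) sequentially"
      "inv (p 0) \<otimes> y \<in> W (k 0)"
      using T.chain_converges[OF complete_T, of p k] pq(1) step(1,2) conj(1) by metis
    obtain z where z: "z \<in> carrier G" "\<And>l. eventually (\<lambda>n. inv z \<otimes> q n \<in> W l) sequentially"
      "inv (q 0) \<otimes> z \<in> W (j 0)"
      using T.chain_converges[OF complete_T, of q j] pq(2) step(3,4) conj(2) by metis
    define w where "w = inv y \<otimes> z"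
    have wc: "w \<in> carrier G" using y z by (simp add: w_def)
    have "y \<in> W k0" "z \<in> W k0" using y z start by auto
    then have "w \<in> W n"
      unfolding w_def k0_def
      using T.mult_step[OF T.inv_step T.decreasingD, of y n z "Suc (Suc n)"] by simp
    moreover have "inv w \<otimes> v \<in> V l" for l
    proof -
      obtain t where t: "\<And>x. x \<in> V t \<Longrightarrow> inv v \<otimes> x \<otimes> inv (inv v) \<in> V (Suc (Suc l))"
        using S.conj_seq[OF S.inv_closed[OF vc]] by blast
      have "eventually (\<lambda>i. inv z \<otimes> q (Suc i) \<in> W (Suc (Suc (Suc l)))) sequentially"
        using z(2) by (subst eventually_sequentially_Suc)
      then have "eventually (\<lambda>i. inv y \<otimes> p i \<in> W t \<and>
          inv z \<otimes> q (Suc i) \<in> W (Suc (Suc (Suc l))) \<and> Suc (Suc l) \<le> i) sequentially"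
        using y(2)[of t] by (intro eventually_conj) (auto intro: eventually_ge_at_top)
      then obtain i where i: "inv y \<otimes> p i \<in> V t" "inv z \<otimes> q (Suc i) \<in> V (Suc (Suc (Suc l)))"
        "Suc (Suc l) \<le> i"
        using finer eventually_happens'[OF sequentially_bot] by blast
      have "inv (p i \<otimes> v) \<otimes> q (Suc i) \<in> V (Suc (Suc l))"
        using step(5) i(3) by (rule S.decreasingD)
      then have "(inv v \<otimes> (inv y \<otimes> p i) \<otimes> inv (inv v)) \<otimes> (inv (p i \<otimes> v) \<otimes> q (Suc i))
          \<otimes> inv (inv z \<otimes> q (Suc i)) \<in> V (Suc l)"
        by (rule S.triple[OF t[OF i(1)] _ S.inv_step[OF i(2)]])
      then have "inv v \<otimes> w \<in> V (Suc l)"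
        using y z vc pq by (simp add: w_def S.group_norm)
      then have "inv (inv v \<otimes> w) \<in> V l" by (rule S.inv_step)
      then show ?thesis using vc wc by (simp add: S.inv_mult_group)
    qed
    ultimately show ?thesis by blast
  qed
  then show ?thesis by blast
qed

end

section \<open>Minimality of separable groups\<close>

text \<open>
  Separability is needed for invariance under conjugation. It is enough to keep \<open>V (Suc n)\<close> small
  under conjugation by the inverses of the first \<open>n\<close> elements of \<open>D\<close>: every \<open>g\<close> is a product
  \<open>a\<inverse> d\<inverse>\<close> with \<open>d \<in> D\<close> and \<open>a\<close> as small as desired, and conjugation by a small element does little
  harm. The small factor stands on the left, so that the bound on it does not depend on the position
  of \<open>d\<close> in the enumeration.
\<close>

lemma (in group_nhds) countable_refinement:
  assumes D: "countable D" "D \<subseteq> carrier G"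
    and dense: "\<And>U g. U \<in> B \<Longrightarrow> g \<in> carrier G \<Longrightarrow> \<exists>d\<in>D. inv d \<otimes> g \<in> U"
    and C: "countable \<C>" "\<C> \<subseteq> B"
  obtains V where "nhds_seq G V" "range V \<subseteq> B" "\<And>C. C \<in> \<C> \<Longrightarrow> \<exists>n. V n \<subseteq> C"
proof -
  obtain U0 where U0: "U0 \<in> B" using nonempty by blast
  define c where "c = from_nat_into (insert U0 \<C>)"
  have c: "c i \<in> B" for i
    using from_nat_into[of "insert U0 \<C>" i] U0 C by (auto simp: c_def)
  have "D \<noteq> {}" using dense[OF U0, of \<one>] by blast
  define d where "d = from_nat_into D"
  have d: "d i \<in> carrier G" for i using D \<open>D \<noteq> {}\<close> by (simp add: d_def from_nat_into subset_iff)
  have conjs: "\<exists>V\<in>B. \<forall>k\<le>n. \<forall>x\<in>V. inv (d k) \<otimes> x \<otimes> d k \<in> U" if U: "U \<in> B" for U and n :: nat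
  proof (induction n)
    case 0
    show ?case using small_conj[OF _ U, of "inv (d 0)"] d by simp
  next
    case (Suc n)
    then obtain V where V: "V \<in> B" "\<forall>k\<le>n. \<forall>x\<in>V. inv (d k) \<otimes> x \<otimes> d k \<in> U" by blast
    obtain V' where V': "V' \<in> B" "\<forall>x\<in>V'. inv (d (Suc n)) \<otimes> x \<otimes> d (Suc n) \<in> U"
      using small_conj[OF _ U, of "inv (d (Suc n))"] d by auto
    obtain W where "W \<in> B" "W \<subseteq> V \<inter> V'" using directed V(1) V'(1) by blast
    then show ?case using V V' by (intro bexI[of _ W]) (auto simp: le_Suc_eq)
  qed
  have "\<exists>V. \<forall>n. V n \<in> B \<and> (V (Suc n) \<subseteq> c n \<and>
     (\<forall>x\<in>V (Suc n). \<forall>y\<in>V (Suc n). \<forall>z\<in>V (Suc n). x \<otimes> y \<otimes> z \<in> V n) \<and>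
     (\<forall>x\<in>V (Suc n). inv x \<in> V n) \<and> (\<forall>k\<le>n. \<forall>x\<in>V (Suc n). inv (d k) \<otimes> x \<otimes> d k \<in> V n))"
  proof (rule dependent_nat_choice)
    show "\<exists>V. V \<in> B" using U0 by blast
    fix U n assume U: "U \<in> B"
    obtain V1 where V1: "V1 \<in> B" "\<And>x. x \<in> V1 \<Longrightarrow> inv x \<in> U"
      "\<And>x y z. x \<in> V1 \<Longrightarrow> y \<in> V1 \<Longrightarrow> z \<in> V1 \<Longrightarrow> x \<otimes> y \<otimes> z \<in> U" using small[OF U] by metis
    obtain V2 where V2: "V2 \<in> B" "\<forall>k\<le>n. \<forall>x\<in>V2. inv (d k) \<otimes> x \<otimes> d k \<in> U"
      using conjs[OF U] by blast
    obtain V3 where V3: "V3 \<in> B" "V3 \<subseteq> V1 \<inter> V2" using directed V1(1) V2(1) by blast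
    obtain V4 where V4: "V4 \<in> B" "V4 \<subseteq> V3 \<inter> c n" using directed V3(1) c by blast
    show "\<exists>V. V \<in> B \<and> (V \<subseteq> c n \<and> (\<forall>x\<in>V. \<forall>y\<in>V. \<forall>z\<in>V. x \<otimes> y \<otimes> z \<in> U) \<and>
       (\<forall>x\<in>V. inv x \<in> U) \<and> (\<forall>k\<le>n. \<forall>x\<in>V. inv (d k) \<otimes> x \<otimes> d k \<in> U))"
      using V1 V2 V3 V4 by (intro exI[of _ V4] conjI ballI allI impI) blast+
  qed
  then obtain V where V0: "\<forall>n. V n \<in> B \<and> (V (Suc n) \<subseteq> c n \<and>
     (\<forall>x\<in>V (Suc n). \<forall>y\<in>V (Suc n). \<forall>z\<in>V (Suc n). x \<otimes> y \<otimes> z \<in> V n) \<and>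
     (\<forall>x\<in>V (Suc n). inv x \<in> V n) \<and> (\<forall>k\<le>n. \<forall>x\<in>V (Suc n). inv (d k) \<otimes> x \<otimes> d k \<in> V n))" ..
  have V: "\<And>n. V n \<in> B" "\<And>n. V (Suc n) \<subseteq> c n"
     "\<And>n x y z. x\<in>V (Suc n) \<Longrightarrow> y\<in>V (Suc n) \<Longrightarrow> z\<in>V (Suc n) \<Longrightarrow> x \<otimes> y \<otimes> z \<in> V n"
     "\<And>n x. x\<in>V (Suc n) \<Longrightarrow> inv x \<in> V n"
     "\<And>n k x. k\<le>n \<Longrightarrow> x\<in>V (Suc n) \<Longrightarrow> inv (d k) \<otimes> x \<otimes> d k \<in> V n"
    using V0 by blast+
  have one: "\<one> \<in> V n" and car: "x \<in> V n \<Longrightarrow> x \<in> carrier G" for n x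
    using V(1) one_in mem_carrier by blast+
  have mult: "x \<otimes> y \<in> V n" if "x \<in> V (Suc n)" "y \<in> V (Suc n)" for x y n
    using V(3)[OF that one] that car by simp
  have dec: "V m \<subseteq> V n" if "n \<le> m" for n m
    using that
  proof (induction rule: dec_induct)
    case (step m)
    have "V (Suc m) \<subseteq> V m" using mult[OF _ one] car by fastforce
    then show ?case using step by blast
  qed simp
  have "nhds_seq G V"
  proof (intro nhds_seq.intro group_nhds.intro group_nhds_axioms.intro nhds_seq_axioms.intro is_group)
    show "range V \<noteq> {}" by simp
    fix P assume "P \<in> range V"
    then obtain n where P: "P = V n" by blast
    show "P \<subseteq> carrier G" "\<one> \<in> P" using P car one by auto
    show "\<exists>V\<in>range V. \<forall>x\<in>V. \<forall>y\<in>V. x \<otimes> y \<in> P" using mult P by blast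
    show "\<exists>V\<in>range V. \<forall>x\<in>V. inv x \<in> P" using V(4) P by blast
    show "\<exists>W\<in>range V. W \<subseteq> P \<inter> Q" if h: "Q \<in> range V" for Q
    proof -
      obtain m where "Q = V m" using h by blast
      then show ?thesis using P dec[of n "max n m"] dec[of m "max n m"] by auto
    qed
    show "\<exists>V\<in>range V. \<forall>x\<in>V. g \<otimes> x \<otimes> inv g \<in> P" if g: "g \<in> carrier G" for g
    proof -
      obtain e where e: "e \<in> D" "inv e \<otimes> inv g \<in> V (Suc (Suc n))"
        using dense[OF V(1) inv_closed[OF g]] by blast
      then obtain k where k: "e = d k"
        unfolding d_def using from_nat_into_surj[OF D(1)] by metis
      define a where "a = inv (d k) \<otimes> inv g"
      have a: "a \<in> V (Suc n)" "inv a \<in> V (Suc n)"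
        using e dec[of "Suc n" "Suc (Suc n)"] V(4) by (auto simp: a_def k)
      define m where "m = max (Suc n) k"
      have "g \<otimes> x \<otimes> inv g \<in> P" if x: "x \<in> V (Suc m)" for x
      proof -
        have "inv (d k) \<otimes> x \<otimes> d k \<in> V (Suc n)"
          using V(5)[of k m x] x dec[of "Suc n" m] by (auto simp: m_def)
        then have "inv a \<otimes> (inv (d k) \<otimes> x \<otimes> d k) \<otimes> a \<in> V n" using a V(3) by blast
        then show ?thesis using g d[of k] car[OF x] by (simp add: a_def P group_norm)
      qed
      then show ?thesis by blast
    qed
  qed (use V in blast)+
  moreover have "\<exists>n. V n \<subseteq> C" if "C \<in> \<C>" for C
  proof -
    have "\<exists>i. c i = C"
      unfolding c_def using from_nat_into_surj[of "insert U0 \<C>" C] C(1) that by auto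
    then show ?thesis using V(2) by blast
  qed
  ultimately show thesis using that V(1) by blast
qed

lemma group_nhds_join:
  assumes "group_nhds G B" "group_nhds G C"
  shows "group_nhds G ((\<lambda>(U, V). U \<inter> V) ` (B \<times> C))"
proof -
  interpret B: group_nhds G B by fact
  interpret C: group_nhds G C by fact
  let ?J = "(\<lambda>(U, V). U \<inter> V) ` (B \<times> C)"
  show ?thesis
  proof (intro group_nhds.intro group_nhds_axioms.intro B.is_group)
    show "?J \<noteq> {}" using B.nonempty C.nonempty by blast
    fix P assume "P \<in> ?J"
    then obtain U V where P: "U \<in> B" "V \<in> C" "P = U \<inter> V" by blast
    show "P \<subseteq> carrier G" using P B.sub by blast
    show "\<one>\<^bsub>G\<^esub> \<in> P" using P B.one_in C.one_in by blast
    have join: "\<exists>W\<in>?J. \<forall>x\<in>W. R x" if h: "\<exists>W\<in>B. \<forall>x\<in>W. R1 x" "\<exists>W\<in>C. \<forall>x\<in>W. R2 x"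
      "\<And>x. R1 x \<Longrightarrow> R2 x \<Longrightarrow> R x" for R1 R2 R
    proof -
      obtain W1 W2 where "W1 \<in> B" "\<forall>x\<in>W1. R1 x" "W2 \<in> C" "\<forall>x\<in>W2. R2 x" using h by blast
      then show ?thesis using h(3) by (intro bexI[of _ "W1 \<inter> W2"]) auto
    qed
    show "\<exists>W\<in>?J. \<forall>x\<in>W. inv\<^bsub>G\<^esub> x \<in> P"
      by (rule join[OF B.small_inv[OF P(1)] C.small_inv[OF P(2)]]) (simp add: P(3))
    show "\<exists>W\<in>?J. \<forall>x\<in>W. g \<otimes>\<^bsub>G\<^esub> x \<otimes>\<^bsub>G\<^esub> inv\<^bsub>G\<^esub> g \<in> P" if "g \<in> carrier G" for g
      by (rule join[OF B.small_conj[OF that P(1)] C.small_conj[OF that P(2)]]) (simp add: P(3))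
    show "\<exists>W\<in>?J. \<forall>x\<in>W. \<forall>y\<in>W. x \<otimes>\<^bsub>G\<^esub> y \<in> P"
    proof -
      obtain W1 W2 where "W1 \<in> B" "\<forall>x\<in>W1. \<forall>y\<in>W1. x \<otimes>\<^bsub>G\<^esub> y \<in> U"
        "W2 \<in> C" "\<forall>x\<in>W2. \<forall>y\<in>W2. x \<otimes>\<^bsub>G\<^esub> y \<in> V" using B.small_mult[OF P(1)] C.small_mult[OF P(2)] by blast
      then show ?thesis using P(3) by (intro bexI[of _ "W1 \<inter> W2"]) auto
    qed
    fix Q assume "Q \<in> ?J"
    then obtain U' V' where Q: "U' \<in> B" "V' \<in> C" "Q = U' \<inter> V'" by blast
    obtain U2 V2 where "U2 \<in> B" "U2 \<subseteq> U \<inter> U'" "V2 \<in> C" "V2 \<subseteq> V \<inter> V'"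
      using B.directed[OF P(1) Q(1)] C.directed[OF P(2) Q(2)] by blast
    then show "\<exists>W\<in>?J. W \<subseteq> P \<inter> Q" using P(3) Q(3) by (intro bexI[of _ "U2 \<inter> V2"]) auto
  qed
qed

lemma nhds_seq_join:
  assumes "nhds_seq G U" "nhds_seq G V"
  shows "nhds_seq G (\<lambda>n. U n \<inter> V n)"
proof -
  interpret U: nhds_seq G U by fact
  interpret V: nhds_seq G V by fact
  let ?J = "\<lambda>n. U n \<inter> V n"
  have ex: "\<exists>W\<in>range ?J. \<forall>x\<in>W. R x" if h: "\<exists>W\<in>range U. \<forall>x\<in>W. R1 x" "\<exists>W\<in>range V. \<forall>x\<in>W. R2 x"
      "\<And>x. R1 x \<Longrightarrow> R2 x \<Longrightarrow> R x" for R1 R2 R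
  proof -
    obtain n1 n2 where "\<forall>x\<in>U n1. R1 x" "\<forall>x\<in>V n2. R2 x" using h by blast
    then have "\<forall>x\<in>?J (max n1 n2). R x"
      using h(3) U.decreasing[of n1 "max n1 n2"] V.decreasing[of n2 "max n1 n2"] by (meson IntE max.cobounded1 max.cobounded2 subsetD)
    then show ?thesis by blast
  qed
  show ?thesis
  proof (intro nhds_seq.intro group_nhds.intro group_nhds_axioms.intro nhds_seq_axioms.intro U.is_group)
    show "range ?J \<noteq> {}" by simp
    fix P assume "P \<in> range ?J"
    then obtain n where P: "P = ?J n" by blast
    show "P \<subseteq> carrier G" "\<one>\<^bsub>G\<^esub> \<in> P" using P U.seq_carrier U.seq_one V.seq_one by auto
    show "\<exists>W\<in>range ?J. \<forall>x\<in>W. \<forall>y\<in>W. x \<otimes>\<^bsub>G\<^esub> y \<in> P"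
      by (rule bexI[of _ "?J (Suc n)"]) (auto simp: P U.mult_step V.mult_step)
    show "\<exists>W\<in>range ?J. \<forall>x\<in>W. inv\<^bsub>G\<^esub> x \<in> P"
      by (rule bexI[of _ "?J (Suc n)"]) (auto simp: P U.inv_step V.inv_step)
    show "\<exists>W\<in>range ?J. \<forall>x\<in>W. g \<otimes>\<^bsub>G\<^esub> x \<otimes>\<^bsub>G\<^esub> inv\<^bsub>G\<^esub> g \<in> P" if "g \<in> carrier G" for g
      by (rule ex[OF U.small_conj[OF that, of "U n"] V.small_conj[OF that, of "V n"]]) (simp_all add: P)
    show "\<exists>W\<in>range ?J. W \<subseteq> P \<inter> Q" if h: "Q \<in> range ?J" for Q
    proof -
      obtain m where "Q = ?J m" using h by blast
      then have "?J (max n m) \<subseteq> P \<inter> Q"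
        using P U.decreasing[of n "max n m"] U.decreasing[of m "max n m"]
          V.decreasing[of n "max n m"] V.decreasing[of m "max n m"] by auto
      then show ?thesis by blast
    qed
  qed (simp_all add: U.triple V.triple U.inv_step V.inv_step)
qed

text \<open>
  The sets \<open>V \<inter> b U\<close> generate a filter that converges to the identity for \<open>\<S>\<close> and to \<open>b\<close> for \<open>\<U>\<close>.
  So it is Cauchy for the join of the two topologies. A limit for the join is the identity, because
  \<open>\<S>\<close> is Hausdorff, and therefore \<open>b\<close> is in the \<open>\<U>\<close>-closure of the identity.
\<close>

lemma common_limit:
  assumes S: "group_nhds G \<S>" and haus: "\<Inter>\<S> \<subseteq> {\<one>\<^bsub>G\<^esub>}"
    and U: "group_nhds G \<U>"
    and complete: "nhds_complete G ((\<lambda>(V, U). V \<inter> U) ` (\<S> \<times> \<U>))"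
    and b: "b \<in> carrier G" and meet: "\<And>V U. V \<in> \<S> \<Longrightarrow> U \<in> \<U> \<Longrightarrow> \<exists>x\<in>V. inv\<^bsub>G\<^esub> b \<otimes>\<^bsub>G\<^esub> x \<in> U"
  shows "b \<in> \<Inter>\<U>"
proof -
  interpret S: group_nhds G \<S> by fact
  interpret U: group_nhds G \<U> by fact
  let ?E = "\<lambda>(V, U). {x \<in> V. inv\<^bsub>G\<^esub> b \<otimes>\<^bsub>G\<^esub> x \<in> U}"
  define F where "F = (INF p\<in>\<S> \<times> \<U>. principal (?E p))"
  have F: "eventually R F \<longleftrightarrow> (\<exists>V\<in>\<S>. \<exists>U\<in>\<U>. \<forall>x\<in>V. inv\<^bsub>G\<^esub> b \<otimes>\<^bsub>G\<^esub> x \<in> U \<longrightarrow> R x)" for R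
    unfolding F_def
  proof (subst eventually_INF_base)
    show "\<S> \<times> \<U> \<noteq> {}" using S.nonempty U.nonempty by blast
    fix p p' assume "p \<in> \<S> \<times> \<U>" "p' \<in> \<S> \<times> \<U>"
    then obtain V U V' U' where p: "p = (V, U)" "p' = (V', U')" "V \<in> \<S>" "U \<in> \<U>" "V' \<in> \<S>" "U' \<in> \<U>"
      by blast
    obtain V2 U2 where "V2 \<in> \<S>" "V2 \<subseteq> V \<inter> V'" "U2 \<in> \<U>" "U2 \<subseteq> U \<inter> U'"
      using S.directed[of V V'] U.directed[of U U'] p by blast
    then show "\<exists>x\<in>\<S> \<times> \<U>. principal (?E x) \<le> inf (principal (?E p)) (principal (?E p'))"
      using p by (intro bexI[of _ "(V2, U2)"]) auto
  qed (auto simp: eventually_principal)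
  have "F \<noteq> bot"
    unfolding trivial_limit_def F using meet by blast
  moreover have "nhds_cauchy G ((\<lambda>(V, U). V \<inter> U) ` (\<S> \<times> \<U>)) F"
    unfolding nhds_cauchy_def
  proof
    fix P assume "P \<in> (\<lambda>(V, U). V \<inter> U) ` (\<S> \<times> \<U>)"
    then obtain V U where P: "V \<in> \<S>" "U \<in> \<U>" "P = V \<inter> U" by blast
    obtain V' where V': "V' \<in> \<S>" "\<And>x y. x \<in> V' \<Longrightarrow> y \<in> V' \<Longrightarrow> inv\<^bsub>G\<^esub> x \<otimes>\<^bsub>G\<^esub> y \<in> V"
      "\<And>x y. x \<in> V' \<Longrightarrow> y \<in> V' \<Longrightarrow> x \<otimes>\<^bsub>G\<^esub> inv\<^bsub>G\<^esub> y \<in> V" using S.small[OF P(1)] by metis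
    obtain U1 where U1: "U1 \<in> \<U>" "\<forall>x\<in>U1. b \<otimes>\<^bsub>G\<^esub> x \<otimes>\<^bsub>G\<^esub> inv\<^bsub>G\<^esub> b \<in> U" using U.small_conj[OF b P(2)] by blast
    obtain U2 where U2: "U2 \<in> \<U>" "U2 \<subseteq> U1 \<inter> U" using U.directed[OF U1(1) P(2)] by blast
    obtain U' where U': "U' \<in> \<U>" "\<And>x y. x \<in> U' \<Longrightarrow> y \<in> U' \<Longrightarrow> inv\<^bsub>G\<^esub> x \<otimes>\<^bsub>G\<^esub> y \<in> U2"
      "\<And>x y. x \<in> U' \<Longrightarrow> y \<in> U' \<Longrightarrow> x \<otimes>\<^bsub>G\<^esub> inv\<^bsub>G\<^esub> y \<in> U2" using U.small[OF U2(1)] by metis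
    have "inv\<^bsub>G\<^esub> x \<otimes>\<^bsub>G\<^esub> y \<in> P \<and> x \<otimes>\<^bsub>G\<^esub> inv\<^bsub>G\<^esub> y \<in> P" if xy: "x \<in> ?E (V', U')" "y \<in> ?E (V', U')" for x y
    proof -
      have c: "x \<in> carrier G" "y \<in> carrier G" using xy S.mem_carrier[OF V'(1)] by auto
      let ?a = "inv\<^bsub>G\<^esub> b \<otimes>\<^bsub>G\<^esub> x" and ?c = "inv\<^bsub>G\<^esub> b \<otimes>\<^bsub>G\<^esub> y"
      have "inv\<^bsub>G\<^esub> ?a \<otimes>\<^bsub>G\<^esub> ?c \<in> U2" "?a \<otimes>\<^bsub>G\<^esub> inv\<^bsub>G\<^esub> ?c \<in> U2" using U'(2,3) xy by auto
      then have "inv\<^bsub>G\<^esub> ?a \<otimes>\<^bsub>G\<^esub> ?c \<in> U" "b \<otimes>\<^bsub>G\<^esub> (?a \<otimes>\<^bsub>G\<^esub> inv\<^bsub>G\<^esub> ?c) \<otimes>\<^bsub>G\<^esub> inv\<^bsub>G\<^esub> b \<in> U" using U1 U2 by auto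
      then have "inv\<^bsub>G\<^esub> x \<otimes>\<^bsub>G\<^esub> y \<in> U" "x \<otimes>\<^bsub>G\<^esub> inv\<^bsub>G\<^esub> y \<in> U"
        using b c by (simp_all add: S.group_norm)
      then show ?thesis using V'(2,3) xy P(3) by auto
    qed
    moreover have "eventually (\<lambda>x. x \<in> ?E (V', U')) F" unfolding F using V'(1) U'(1) by auto
    ultimately show "\<exists>A. eventually (\<lambda>x. x \<in> A) F \<and> A \<subseteq> carrier G \<and>
        (\<forall>x\<in>A. \<forall>y\<in>A. inv\<^bsub>G\<^esub> x \<otimes>\<^bsub>G\<^esub> y \<in> P \<and> x \<otimes>\<^bsub>G\<^esub> inv\<^bsub>G\<^esub> y \<in> P)"
      using S.mem_carrier[OF V'(1)] by (intro exI[of _ "?E (V', U')"]) auto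
  qed
  ultimately obtain z where "nhds_limit G ((\<lambda>(V, U). V \<inter> U) ` (\<S> \<times> \<U>)) F z"
    using complete unfolding nhds_complete_def by blast
  then have z: "z \<in> carrier G"
    "\<And>V U. V \<in> \<S> \<Longrightarrow> U \<in> \<U> \<Longrightarrow> eventually (\<lambda>x. inv\<^bsub>G\<^esub> z \<otimes>\<^bsub>G\<^esub> x \<in> V \<inter> U) F"
    by (auto simp: nhds_limit_def)
  have hit: "\<exists>x. x \<in> V \<and> inv\<^bsub>G\<^esub> b \<otimes>\<^bsub>G\<^esub> x \<in> U \<and> inv\<^bsub>G\<^esub> z \<otimes>\<^bsub>G\<^esub> x \<in> V \<and> inv\<^bsub>G\<^esub> z \<otimes>\<^bsub>G\<^esub> x \<in> U"
    if "V \<in> \<S>" "U \<in> \<U>" for V U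
  proof -
    have "eventually (\<lambda>x. x \<in> V \<and> inv\<^bsub>G\<^esub> b \<otimes>\<^bsub>G\<^esub> x \<in> U) F" unfolding F using that by blast
    then have "eventually (\<lambda>x. (x \<in> V \<and> inv\<^bsub>G\<^esub> b \<otimes>\<^bsub>G\<^esub> x \<in> U) \<and> inv\<^bsub>G\<^esub> z \<otimes>\<^bsub>G\<^esub> x \<in> V \<inter> U) F"
      using z(2)[OF that] by (rule eventually_conj)
    then show ?thesis using eventually_happens'[OF \<open>F \<noteq> bot\<close>] by blast
  qed
  have "z \<in> V" if h: "V \<in> \<S>" for V
  proof -
    obtain V' where V': "V' \<in> \<S>" "\<And>x y. x \<in> V' \<Longrightarrow> y \<in> V' \<Longrightarrow> x \<otimes>\<^bsub>G\<^esub> inv\<^bsub>G\<^esub> y \<in> V"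
      using S.small[OF h] by metis
    obtain U where "U \<in> \<U>" using U.nonempty by blast
    then obtain x where x: "x \<in> V'" "inv\<^bsub>G\<^esub> z \<otimes>\<^bsub>G\<^esub> x \<in> V'" using hit[OF V'(1)] by blast
    have "x \<otimes>\<^bsub>G\<^esub> inv\<^bsub>G\<^esub> (inv\<^bsub>G\<^esub> z \<otimes>\<^bsub>G\<^esub> x) = z"
      using z(1) S.mem_carrier[OF V'(1) x(1)] by (simp add: S.group_norm)
    then show ?thesis using V'(2)[OF x] by simp
  qed
  then have z1: "z = \<one>\<^bsub>G\<^esub>" using haus by blast
  have "b \<in> U" if h: "U \<in> \<U>" for U
  proof -
    obtain U' where U': "U' \<in> \<U>" "\<And>x y. x \<in> U' \<Longrightarrow> y \<in> U' \<Longrightarrow> x \<otimes>\<^bsub>G\<^esub> inv\<^bsub>G\<^esub> y \<in> U"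
      using U.small[OF h] by metis
    obtain V where "V \<in> \<S>" using S.nonempty by blast
    then obtain x where x: "inv\<^bsub>G\<^esub> b \<otimes>\<^bsub>G\<^esub> x \<in> U'" "inv\<^bsub>G\<^esub> z \<otimes>\<^bsub>G\<^esub> x \<in> U'" "x \<in> V"
      using hit[OF _ U'(1)] by blast
    have xc: "x \<in> carrier G" using x(3) S.mem_carrier[OF \<open>V \<in> \<S>\<close>] by blast
    then have "x \<in> U'" using x(2) z1 by simp
    then have "x \<otimes>\<^bsub>G\<^esub> inv\<^bsub>G\<^esub> (inv\<^bsub>G\<^esub> b \<otimes>\<^bsub>G\<^esub> x) \<in> U" using U'(2) x(1) by blast
    then show ?thesis using b xc by (simp add: S.group_norm)
  qed
  then show ?thesis by blast
qed

text \<open>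
  Refine \<open>P\<close> by a sequence \<open>U\<close> from \<open>\<T>\<close>, with \<open>\<Inter>(range U) = N\<close>. By \<open>common_limit\<close>, each point
  \<open>b\<close> outside \<open>N\<close> has a neighbourhood \<open>b U\<^sub>i\<close> that misses some member of \<open>\<S>\<close>. As in a Lindelof
  space, countably many members of \<open>\<S>\<close> serve all these points, because a point may be replaced by a
  nearby element of \<open>D\<close>. So there is a sequence \<open>V\<close> in \<open>\<S>\<close> with \<open>\<Inter>(range V) \<subseteq> N\<close>. The open mapping
  theorem, applied to \<open>V\<close> and the join of \<open>U\<close> with \<open>V\<close>, provides an \<open>m\<close> with \<open>V m \<subseteq> U (Suc n) N \<subseteq> P\<close>.
\<close>

theorem separable_minimal:
  assumes T: "group_nhds G \<T>" and D: "countable D" "D \<subseteq> carrier G"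
    and dense: "\<And>U g. U \<in> \<T> \<Longrightarrow> g \<in> carrier G \<Longrightarrow> \<exists>d\<in>D. inv\<^bsub>G\<^esub> d \<otimes>\<^bsub>G\<^esub> g \<in> U"
    and complete: "\<And>B. group_nhds G B \<Longrightarrow> (\<And>U. U \<in> B \<Longrightarrow> \<exists>V\<in>\<T>. V \<subseteq> U) \<Longrightarrow> nhds_complete G B"
    and S: "group_nhds G \<S>" and coarse: "\<And>U. U \<in> \<S> \<Longrightarrow> \<exists>V\<in>\<T>. V \<subseteq> U"
    and haus: "\<Inter>\<S> \<subseteq> {\<one>\<^bsub>G\<^esub>}"
    and P: "P \<in> \<T>"
  shows "\<exists>V\<in>\<S>. V \<subseteq> P"
proof -
  interpret T: group_nhds G \<T> by fact
  interpret S: group_nhds G \<S> by fact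
  have denseS: "\<exists>d\<in>D. inv\<^bsub>G\<^esub> d \<otimes>\<^bsub>G\<^esub> g \<in> U" if "U \<in> \<S>" "g \<in> carrier G" for U g
    using coarse[OF that(1)] dense[OF _ that(2)] by blast
  obtain U where U: "nhds_seq G U" "range U \<subseteq> \<T>" "\<exists>n. U n \<subseteq> P"
    using T.countable_refinement[OF D dense, of "{P}"] P by auto
  interpret U: nhds_seq G U by (rule U(1))
  obtain n where n: "U n \<subseteq> P" using U(3) by blast
  have "nhds_complete G ((\<lambda>(V, U). V \<inter> U) ` (\<S> \<times> range U))"
  proof (rule complete[OF group_nhds_join[OF S U.group_nhds_axioms]])
    fix Q assume "Q \<in> (\<lambda>(V, U). V \<inter> U) ` (\<S> \<times> range U)"
    then obtain V i where Q: "V \<in> \<S>" "Q = V \<inter> U i" by blast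
    obtain V' where "V' \<in> \<T>" "V' \<subseteq> V" using coarse Q(1) by blast
    then show "\<exists>V\<in>\<T>. V \<subseteq> Q" using Q(2) T.directed[of V' "U i"] U(2) by blast
  qed
  note limit = common_limit[OF S haus U.group_nhds_axioms this]
  have sep: "\<exists>V\<in>\<S>. \<exists>i. \<forall>x\<in>V. inv\<^bsub>G\<^esub> b \<otimes>\<^bsub>G\<^esub> x \<notin> U i" if "b \<in> carrier G" "b \<notin> \<Inter>(range U)" for b
    using limit[OF that(1)] that(2) by blast
  define R where "R = {(d, i) \<in> D \<times> UNIV. \<exists>V\<in>\<S>. \<forall>x\<in>V. inv\<^bsub>G\<^esub> d \<otimes>\<^bsub>G\<^esub> x \<notin> U i}"
  (* c (d, i) is a member of the coarser base that misses the translate d U(i) *)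
  define c where "c = (\<lambda>(d, i). SOME V. V \<in> \<S> \<and> (\<forall>x\<in>V. inv\<^bsub>G\<^esub> d \<otimes>\<^bsub>G\<^esub> x \<notin> U i))"
  have c: "c (d, i) \<in> \<S> \<and> (\<forall>x\<in>c (d, i). inv\<^bsub>G\<^esub> d \<otimes>\<^bsub>G\<^esub> x \<notin> U i)" if "(d, i) \<in> R" for d i
    using someI_ex[of "\<lambda>V. V \<in> \<S> \<and> (\<forall>x\<in>V. inv\<^bsub>G\<^esub> d \<otimes>\<^bsub>G\<^esub> x \<notin> U i)"] that
    unfolding R_def c_def by auto
  have "countable R"
    by (rule countable_subset[of _ "D \<times> UNIV"]) (auto simp: R_def D(1))
  then have cR: "countable (c ` R)" "c ` R \<subseteq> \<S>" using c by auto
  have avoid: "\<exists>C\<in>c ` R. b \<notin> C" if b: "b \<in> carrier G" "b \<notin> \<Inter>(range U)" for b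
  proof -
    obtain V i where V: "V \<in> \<S>" "\<forall>x\<in>V. inv\<^bsub>G\<^esub> b \<otimes>\<^bsub>G\<^esub> x \<notin> U i" using sep[OF b] by blast
    obtain d where d: "d \<in> D" "inv\<^bsub>G\<^esub> d \<otimes>\<^bsub>G\<^esub> b \<in> U (Suc (Suc i))"
      using dense[of "U (Suc (Suc i))" b] U(2) b(1) by blast
    have dc: "d \<in> carrier G" using d D by blast
    have "inv\<^bsub>G\<^esub> d \<otimes>\<^bsub>G\<^esub> x \<notin> U (Suc i)" if x: "x \<in> V" for x
    proof
      assume "inv\<^bsub>G\<^esub> d \<otimes>\<^bsub>G\<^esub> x \<in> U (Suc i)"
      then have "inv\<^bsub>G\<^esub> (inv\<^bsub>G\<^esub> d \<otimes>\<^bsub>G\<^esub> b) \<otimes>\<^bsub>G\<^esub> (inv\<^bsub>G\<^esub> d \<otimes>\<^bsub>G\<^esub> x) \<in> U i"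
        using U.inv_step[OF d(2)] U.mult_step by blast
      then have "inv\<^bsub>G\<^esub> b \<otimes>\<^bsub>G\<^esub> x \<in> U i"
        using dc b(1) S.mem_carrier[OF V(1) x] by (simp add: T.group_norm)
      then show False using V(2) x by blast
    qed
    then have dR: "(d, Suc i) \<in> R" using V(1) d(1) unfolding R_def by blast
    moreover have "b \<notin> c (d, Suc i)"
      using c[OF dR] d(2) U.decreasingD[OF d(2), of "Suc i"] by auto
    ultimately show ?thesis by blast
  qed
  obtain V where V: "nhds_seq G V" "range V \<subseteq> \<S>" "\<And>C. C \<in> c ` R \<Longrightarrow> \<exists>n. V n \<subseteq> C"
    using S.countable_refinement[OF D denseS cR] by metis
  interpret V: nhds_seq G V by (rule V(1))
  have NV: "\<Inter>(range V) \<subseteq> \<Inter>(range U)"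
  proof
    fix b assume b: "b \<in> \<Inter>(range V)"
    then have "b \<in> carrier G" using V.seq_carrier[of b 0] by blast
    show "b \<in> \<Inter>(range U)"
    proof (rule ccontr)
      assume "b \<notin> \<Inter>(range U)"
      then obtain C where C: "C \<in> c ` R" "b \<notin> C" using avoid[OF \<open>b \<in> carrier G\<close>] by metis
      obtain i where "V i \<subseteq> C" using V(3)[OF C(1)] by blast
      then show False using b C(2) by blast
    qed
  qed
  have "nhds_seq_pair G V (\<lambda>n. U n \<inter> V n) D"
  proof (intro nhds_seq_pair.intro nhds_seq_pair_axioms.intro V(1) nhds_seq_join[OF U(1) V(1)] D)
    have fine: "\<exists>W\<in>\<T>. W \<subseteq> U i \<inter> V i" for i
    proof -
      obtain W where "W \<in> \<T>" "W \<subseteq> V i" using coarse[of "V i"] V(2) by blast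
      then show ?thesis using T.directed[of W "U i"] U(2) by blast
    qed
    show "nhds_complete G (range V)"
      by (rule complete[OF V.group_nhds_axioms]) (use coarse V(2) in \<open>metis subsetD\<close>)
    show "nhds_complete G (range (\<lambda>n. U n \<inter> V n))"
      by (rule complete[OF nhds_seq.axioms(1)[OF nhds_seq_join[OF U(1) V(1)]]]) (use fine in fastforce)
    show "\<exists>d\<in>D. inv\<^bsub>G\<^esub> d \<otimes>\<^bsub>G\<^esub> g \<in> U i \<inter> V i" if "g \<in> carrier G" for g i
      using fine[of i] dense[OF _ that] by blast
  qed simp
  from nhds_seq_pair.open_mapping[OF this, of "Suc n"]
  obtain m where m: "\<forall>v\<in>V m. \<exists>w\<in>U (Suc n) \<inter> V (Suc n). inv\<^bsub>G\<^esub> w \<otimes>\<^bsub>G\<^esub> v \<in> \<Inter>(range V)"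
    by (rule exE)
  have "V m \<subseteq> P"
  proof
    fix v assume v: "v \<in> V m"
    then obtain w where w: "w \<in> U (Suc n)" "inv\<^bsub>G\<^esub> w \<otimes>\<^bsub>G\<^esub> v \<in> U (Suc n)" 
      using bspec[OF m v] subsetD[OF NV] by (metis INT_E IntE UNIV_I)
    then have "w \<otimes>\<^bsub>G\<^esub> (inv\<^bsub>G\<^esub> w \<otimes>\<^bsub>G\<^esub> v) \<in> U n" by (rule U.mult_step)
    then show "v \<in> P"
      using n U.seq_carrier[OF w(1)] V.seq_carrier[OF v] by (auto simp: T.group_norm)
  qed
  then show ?thesis using V(2) by (metis rangeI subsetD)
qed

lemma (in group) countable_subgroup:
  assumes C: "countable C" "C \<subseteq> carrier G"
  obtains D where "subgroup D G" "countable D" "C \<subseteq> D"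
proof -
  define X where "X = C \<union> (\<lambda>x. inv x) ` C"
  (* the subgroup consists of the words in C and its inverses *)
  define w where "w = (\<lambda>l. foldr (\<otimes>) l \<one>)"
  have X: "X \<subseteq> carrier G" "countable X" using C by (auto simp: X_def)
  have Xinv: "inv x \<in> X" if "x \<in> X" for x using that C(2) by (auto simp: X_def)
  have wc: "w l \<in> carrier G" if "l \<in> lists X" for l
    using that X(1) by (induction l) (auto simp: w_def)
  have app: "w (l @ l') = w l \<otimes> w l'" if "l \<in> lists X" "l' \<in> lists X" for l l'
    using that(1)
  proof (induction l)
    case Nil then show ?case using wc[OF that(2)] by (simp add: w_def)
  next
    case (Cons x l)
    then have "w ((x # l) @ l') = x \<otimes> (w l \<otimes> w l')" by (simp add: w_def)
    also have "\<dots> = w (x # l) \<otimes> w l'"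
      using Cons X(1) wc[OF that(2)] wc[of l] by (simp add: w_def m_assoc subset_iff)
    finally show ?case .
  qed
  have sing: "w [x] = x" if "x \<in> X" for x using that X(1) by (auto simp: w_def)
  have winv: "inv (w l) \<in> w ` lists X" if "l \<in> lists X" for l
    using that
  proof (induction l)
    case Nil show ?case by (rule image_eqI[of _ _ "[]"]) (auto simp: w_def)
  next
    case (Cons x l)
    then obtain l' where l': "l' \<in> lists X" "inv (w l) = w l'" by auto
    have "inv (w (x # l)) = inv (w l) \<otimes> inv x"
      using Cons X(1) wc[of l] by (simp add: w_def inv_mult_group subset_iff)
    also have "\<dots> = w (l' @ [inv x])"
      using app[of l' "[inv x]"] l' Xinv Cons sing by simp
    finally show ?case using l' Xinv Cons by (intro image_eqI[of _ w "l' @ [inv x]"]) auto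
  qed
  have "subgroup (w ` lists X) G"
  proof (rule subgroupI)
    show "w ` lists X \<noteq> {}" by blast
    fix a b assume "a \<in> w ` lists X" "b \<in> w ` lists X"
    then obtain l l' where "l \<in> lists X" "a = w l" "l' \<in> lists X" "b = w l'" by blast
    then show "a \<otimes> b \<in> w ` lists X"
      using app[of l l'] by (intro image_eqI[of _ w "l @ l'"]) auto
  qed (use wc winv in auto)
  moreover have "C \<subseteq> w ` lists X"
  proof
    fix x assume "x \<in> C"
    then show "x \<in> w ` lists X" using sing[of x] by (intro image_eqI[of _ _ "[x]"]) (auto simp: X_def)
  qed
  moreover have "countable (w ` lists X)" using X(2) by (intro countable_image countable_lists)
  ultimately show thesis using that by metis
qed

text \<open>
  \<open>S\<close> is the closure of a countable subgroup that \<open>f\<close> maps onto a superset of \<open>C\<close>. Thus \<open>f ` S\<close> is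
  separable for the topology of the images of the open sets of \<open>S\<close>, and since \<open>S\<close> is
  \<open>h\<close>-complete, all coarser group topologies are complete. By \<open>separable_minimal\<close> the subspace
  topology of \<open>f ` S\<close> is not strictly coarser.
\<close>

lemma open_on_separable_subgroup:
  fixes G :: "('a, 'm) monoid_scheme" and H :: "('b, 'n) monoid_scheme"
  assumes G: "topological_group G TG" and her: "hereditarily_h_complete G TG"
    and H: "topological_group H TH" and f: "f \<in> hom G H" and cont: "continuous_map TG TH f"
    and C: "countable C" "C \<subseteq> f ` carrier G"
  obtains S where "subgroup S G" "C \<subseteq> f ` S" "closedin TH (f ` S)"
    "\<And>W. openin TG W \<Longrightarrow> \<one>\<^bsub>G\<^esub> \<in> W \<Longrightarrow> \<exists>V. openin TH V \<and> \<one>\<^bsub>H\<^esub> \<in> V \<and> V \<inter> f ` S \<subseteq> f ` (W \<inter> S)"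
proof -
  interpret G: group G using topological_groupD(1)[OF G] .
  interpret H: group H using topological_groupD(1)[OF H] .
  interpret f: group_hom G H f
    by (intro group_hom.intro group_hom_axioms.intro G.is_group H.is_group f)
  have tsG: "topspace TG = carrier G" using topological_groupD(2)[OF G] .
  have tsH: "topspace TH = carrier H" using topological_groupD(2)[OF H] .
  obtain C' where C': "countable C'" "C' \<subseteq> carrier G" "C = f ` C'"
    using C countable_subset_image by metis
  obtain D where D: "subgroup D G" "countable D" "C' \<subseteq> D"
    using G.countable_subgroup[OF C'(1,2)] by blast
  define S where "S = TG closure_of D"
  have S: "subgroup S G" unfolding S_def by (rule subgroup_closure_of[OF G D(1)])
  have DS: "D \<subseteq> S" unfolding S_def using subgroup.subset[OF D(1)] tsG by (simp add: closure_of_subset)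
  have Sc: "S \<subseteq> carrier G" by (rule subgroup.subset[OF S])
  define GS TS where "GS = G\<lparr>carrier := S\<rparr>" and "TS = subtopology TG S"
  have carGS: "carrier GS = S" "\<one>\<^bsub>GS\<^esub> = \<one>\<^bsub>G\<^esub>" by (simp_all add: GS_def)
  have GS: "topological_group GS TS"
    unfolding GS_def TS_def by (rule topological_group_subgroup[OF G S])
  have hS: "h_complete GS TS"
    using her S unfolding hereditarily_h_complete_def GS_def TS_def S_def by simp
  have tsS: "topspace TS = S" using topological_groupD(2)[OF GS] carGS by simp
  have fS: "f \<in> hom GS H" using Sc by (auto simp: hom_def GS_def subset_iff)
  have contS: "continuous_map TS TH f"
    unfolding TS_def using cont by (rule continuous_map_from_subtopology)
  have closed: "closedin TH (f ` S)"
    using h_complete_closed_image[OF topological_groupD(1,2)[OF GS] hS H fS contS] carGS by simp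
  define R where "R = f ` S"
  have R: "subgroup R H"
    unfolding R_def using group_hom.img_is_subgroup[of GS H f] fS topological_groupD(1)[OF GS] H.is_group
    by (simp add: group_hom_def group_hom_axioms_def carGS)
  define HR TR where "HR = H\<lparr>carrier := R\<rparr>" and "TR = subtopology TH R"
  have carHR: "carrier HR = R" "\<one>\<^bsub>HR\<^esub> = \<one>\<^bsub>H\<^esub>" by (simp_all add: HR_def)
  have HR: "topological_group HR TR"
    unfolding HR_def TR_def by (rule topological_group_subgroup[OF H R])
  have fR: "f \<in> hom GS HR" using fS by (auto simp: hom_def HR_def R_def carGS)
  have onto: "f ` carrier GS = carrier HR" by (simp add: carGS carHR R_def)
  interpret GS: group_nhds GS "{W. openin TS W \<and> \<one>\<^bsub>GS\<^esub> \<in> W}" by (rule group_nhds_open[OF GS])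
  interpret fR: group_hom GS HR f
    by (intro group_hom.intro group_hom_axioms.intro GS.is_group fR topological_groupD(1)[OF HR])
  define \<T> where "\<T> = (\<lambda>W. f ` W) ` {W. openin TS W \<and> \<one>\<^bsub>GS\<^esub> \<in> W}"
  define \<S> where "\<S> = {V. openin TR V \<and> \<one>\<^bsub>HR\<^esub> \<in> V}"
  have nT: "group_nhds HR \<T>"
    unfolding \<T>_def using topological_groupD(1)[OF HR] fR onto by (rule GS.group_nhds_image)
  have nS: "group_nhds HR \<S>" unfolding \<S>_def by (rule group_nhds_open[OF HR])
  have dense: "\<exists>d\<in>f ` D. inv\<^bsub>HR\<^esub> d \<otimes>\<^bsub>HR\<^esub> g \<in> U" if U: "U \<in> \<T>" and g: "g \<in> carrier HR" for U g
  proof -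
    obtain W where W: "openin TS W" "\<one>\<^bsub>GS\<^esub> \<in> W" "U = f ` W" using U unfolding \<T>_def by blast
    obtain s where s: "s \<in> S" "g = f s" using g unfolding carHR R_def by blast
    obtain V where V: "openin TS V" "\<one>\<^bsub>GS\<^esub> \<in> V" "\<forall>x\<in>V. inv\<^bsub>GS\<^esub> x \<in> W"
      using GS.small_inv[of W] W by blast
    have "openin TS {x \<in> S. inv\<^bsub>GS\<^esub> s \<otimes>\<^bsub>GS\<^esub> x \<in> V}"
      using openin_left_translate[OF GS V(1), of s] s carGS by simp
    then obtain V' where V': "openin TG V'" "{x \<in> S. inv\<^bsub>GS\<^esub> s \<otimes>\<^bsub>GS\<^esub> x \<in> V} = V' \<inter> S"
      unfolding TS_def openin_subtopology by blast
    have "s \<in> {x \<in> S. inv\<^bsub>GS\<^esub> s \<otimes>\<^bsub>GS\<^esub> x \<in> V}" using s V(2) carGS GS.l_inv[of s] by simp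
    then obtain d where d: "d \<in> D" "d \<in> V'"
      using V' s(1) unfolding S_def in_closure_of by blast
    then have dV: "d \<in> S" "inv\<^bsub>GS\<^esub> s \<otimes>\<^bsub>GS\<^esub> d \<in> V" using V'(2) DS by blast+
    have sd: "s \<in> carrier GS" "d \<in> carrier GS" using s dV(1) carGS by simp_all
    have "inv\<^bsub>GS\<^esub> (inv\<^bsub>GS\<^esub> s \<otimes>\<^bsub>GS\<^esub> d) \<in> W" using V(3) dV(2) by blast
    then have "inv\<^bsub>GS\<^esub> d \<otimes>\<^bsub>GS\<^esub> s \<in> W" using sd by (simp add: GS.group_norm)
    then have "f (inv\<^bsub>GS\<^esub> d \<otimes>\<^bsub>GS\<^esub> s) \<in> U" using W by blast
    then have "inv\<^bsub>HR\<^esub> (f d) \<otimes>\<^bsub>HR\<^esub> g \<in> U" using s(2) sd by simp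
    then show ?thesis using d(1) by blast
  qed
  have "\<exists>V\<in>\<S>. V \<subseteq> f ` (W \<inter> S)" if W: "openin TG W" "\<one>\<^bsub>G\<^esub> \<in> W" for W
  proof (rule separable_minimal[OF nT _ _ dense _ nS])
    show "countable (f ` D)" using D(2) by simp
    show "f ` D \<subseteq> carrier HR" using DS by (auto simp: carHR R_def)
    show "\<Inter>\<S> \<subseteq> {\<one>\<^bsub>HR\<^esub>}" unfolding \<S>_def by (rule Inter_open_nhds[OF HR])
    have "openin TS (W \<inter> S)" unfolding TS_def openin_subtopology using W by blast
    then show "f ` (W \<inter> S) \<in> \<T>"
      unfolding \<T>_def using W(2) subgroup.one_closed[OF S] by (auto simp: carGS)
    show "\<exists>V\<in>\<T>. V \<subseteq> U" if "U \<in> \<S>" for U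
    proof -
      have "openin TH (V' )\<Longrightarrow> openin TS {x \<in> topspace TS. f x \<in> V'}" for V'
        using contS by (rule openin_continuous_map_preimage)
      moreover obtain V' where V': "openin TH V'" "U = V' \<inter> R" "\<one>\<^bsub>HR\<^esub> \<in> U"
        using \<open>U \<in> \<S>\<close> unfolding \<S>_def TR_def openin_subtopology by blast
      ultimately have "{x \<in> topspace TS. f x \<in> V'} \<in> {W. openin TS W \<and> \<one>\<^bsub>GS\<^esub> \<in> W}"
        using fR.hom_one GS.one_closed by (auto simp: tsS carGS)
      then have "f ` {x \<in> topspace TS. f x \<in> V'} \<in> \<T>" unfolding \<T>_def by blast
      then show ?thesis by (rule bexI[rotated]) (auto simp: V'(2) tsS R_def)
    qed
    show "nhds_complete HR B" if "group_nhds HR B" "\<And>U. U \<in> B \<Longrightarrow> \<exists>V\<in>\<T>. V \<subseteq> U" for B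
    proof (rule h_complete_imp_nhds_complete[OF GS hS that(1) fR onto])
      fix U assume "U \<in> B"
      then show "\<exists>W. openin TS W \<and> \<one>\<^bsub>GS\<^esub> \<in> W \<and> f ` W \<subseteq> U" using that(2) unfolding \<T>_def by blast
    qed
  qed
  then have "\<exists>V. openin TH V \<and> \<one>\<^bsub>H\<^esub> \<in> V \<and> V \<inter> f ` S \<subseteq> f ` (W \<inter> S)"
    if "openin TG W" "\<one>\<^bsub>G\<^esub> \<in> W" for W
    using that unfolding \<S>_def TR_def openin_subtopology R_def[symmetric] carHR by blast
  moreover have "C \<subseteq> f ` S" using C'(3) D(3) DS by blast
  ultimately show thesis using that S closed by blast
qed

section \<open>Compactness of complete totally bounded sets\<close>

lemma ultrafilter_exists:
  fixes F :: "'a filter"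
  assumes "F \<noteq> bot"
  obtains M where "M \<le> F" "M \<noteq> bot" "\<And>P. eventually P M \<or> eventually (\<lambda>x. \<not> P x) M"
proof -
  (* finer filters have more eventual properties, so E turns minimal filters into maximal sets *)
  define E where "E = (\<lambda>F :: 'a filter. {P. eventually P F})"
  define \<A> where "\<A> = E ` {M. M \<le> F \<and> M \<noteq> bot}"
  have E: "E M \<subseteq> E M' \<longleftrightarrow> M' \<le> M" for M M' by (auto simp: E_def le_filter_def)
  have "\<exists>M\<in>\<A>. \<forall>X\<in>\<A>. M \<subseteq> X \<longrightarrow> X = M"
  proof (rule subset_Zorn_nonempty)
    show "\<A> \<noteq> {}" using assms by (auto simp: \<A>_def)
    fix \<C> assume \<C>: "\<C> \<noteq> {}" "subset.chain \<A> \<C>"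
    define \<Phi> where "\<Phi> = {M. M \<le> F \<and> M \<noteq> bot \<and> E M \<in> \<C>}"
    have sub: "\<C> \<subseteq> \<A>" and chain: "X \<subseteq> Y \<or> Y \<subseteq> X" if "X \<in> \<C>" "Y \<in> \<C>" for X Y
      using \<C>(2) that by (auto simp: subset_chain_def)
    have \<C>\<Phi>: "\<C> = E ` \<Phi>" using \<C> by (auto simp: \<Phi>_def \<A>_def subset_chain_def)
    then have "\<Phi> \<noteq> {}" using \<C>(1) by blast
    have ev: "eventually P (Inf \<Phi>) \<longleftrightarrow> (\<exists>M\<in>\<Phi>. eventually P M)" for P
    proof (rule eventually_Inf_base[OF \<open>\<Phi> \<noteq> {}\<close>])
      fix M M' assume M: "M \<in> \<Phi>" "M' \<in> \<Phi>"
      then have "E M \<subseteq> E M' \<or> E M' \<subseteq> E M" using chain \<C>\<Phi> by blast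
      then have "M' \<le> M \<or> M \<le> M'" unfolding E .
      then show "\<exists>x\<in>\<Phi>. x \<le> inf M M'" using M by auto
    qed
    have "Inf \<Phi> \<le> F" using \<open>\<Phi> \<noteq> {}\<close> by (auto simp: \<Phi>_def intro: Inf_lower2)
    moreover have "Inf \<Phi> \<noteq> bot" unfolding trivial_limit_def ev by (auto simp: \<Phi>_def trivial_limit_def)
    moreover have "\<Union>\<C> = E (Inf \<Phi>)" unfolding \<C>\<Phi> by (auto simp: E_def ev)
    ultimately show "\<Union>\<C> \<in> \<A>" by (auto simp: \<A>_def)
  qed
  then obtain M where M: "M \<le> F" "M \<noteq> bot" "\<And>X. X \<in> \<A> \<Longrightarrow> E M \<subseteq> X \<Longrightarrow> X = E M"
    unfolding \<A>_def by blast
  have "eventually P M \<or> eventually (\<lambda>x. \<not> P x) M" for P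
  proof (cases "inf M (principal {x. P x}) = bot")
    case True
    then have "eventually (\<lambda>x. False) (inf M (principal {x. P x}))" by simp
    then show ?thesis unfolding eventually_inf_principal by simp
  next
    case False
    have "inf M (principal {x. P x}) \<le> F" using M(1) by (rule le_infI1)
    then have "E (inf M (principal {x. P x})) = E M"
      using False by (intro M(3)) (auto simp: \<A>_def E)
    moreover have "P \<in> E (inf M (principal {x. P x}))" by (simp add: E_def eventually_inf_principal)
    ultimately show ?thesis by (simp add: E_def)
  qed
  then show thesis using that M by blast
qed

text \<open>
  By total boundedness an ultrafilter on \<open>K\<close> is concentrated on one of finitely many small sets, for
  every notion of smallness. So it is Cauchy, and its limit belongs to all closed sets on which it is
  concentrated.
\<close>

lemma (in group_nhds) compactin_if_complete_totally_bounded: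
  assumes complete: "nhds_complete G B" and K: "closedin (nhds_topology G B) K"
    and tb: "\<And>U. U \<in> B \<Longrightarrow> \<exists>A. finite A \<and> A \<subseteq> carrier G \<and> (\<forall>y\<in>K. \<exists>a\<in>A. inv a \<otimes> y \<in> U \<and> a \<otimes> inv y \<in> U)"
  shows "compactin (nhds_topology G B) K"
  unfolding compactin_fip
proof (intro conjI allI impI)
  show sub: "K \<subseteq> topspace (nhds_topology G B)" using K closedin_subset by blast
  then have Kc: "K \<subseteq> carrier G" by (simp add: topspace_nhds_topology)
  fix \<U> assume \<U>: "(\<forall>C\<in>\<U>. closedin (nhds_topology G B) C) \<and>
    (\<forall>\<F>. finite \<F> \<and> \<F> \<subseteq> \<U> \<longrightarrow> K \<inter> \<Inter>\<F> \<noteq> {})"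
  have "(INF C\<in>insert K \<U>. principal C) \<noteq> bot"
  proof (rule INF_filter_not_bot)
    fix X assume X: "X \<subseteq> insert K \<U>" "finite X"
    have "K \<inter> \<Inter>(X - {K}) \<noteq> {}" using \<U> X by (metis Diff_subset_conv finite_Diff insert_is_Un)
    then have "\<Inter>X \<noteq> {}" by blast
    then show "(INF C\<in>X. principal C) \<noteq> bot"
      using X(2) by (simp add: INF_principal_finite principal_eq_bot_iff)
  qed
  then obtain M where M: "M \<le> (INF C\<in>insert K \<U>. principal C)" "M \<noteq> bot"
    "\<And>P. eventually P M \<or> eventually (\<lambda>x. \<not> P x) M" using ultrafilter_exists by blast
  have inM: "eventually (\<lambda>x. x \<in> C) M" if "C \<in> insert K \<U>" for C
  proof -
    have "M \<le> principal C" using M(1) that by (meson INF_lower order_trans)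
    then show ?thesis by (simp add: le_principal)
  qed
  have "nhds_cauchy G B M"
    unfolding nhds_cauchy_def
  proof
    fix U assume "U \<in> B"
    then obtain V where V: "V \<in> B" "\<And>x y. x \<in> V \<Longrightarrow> y \<in> V \<Longrightarrow> inv x \<otimes> y \<in> U"
      using small by metis
    obtain A where A: "finite A" "A \<subseteq> carrier G" "\<forall>y\<in>K. \<exists>a\<in>A. inv a \<otimes> y \<in> V \<and> a \<otimes> inv y \<in> V"
      using tb[OF V(1)] by blast
    have "\<exists>a\<in>A. eventually (\<lambda>y. inv a \<otimes> y \<in> V \<and> a \<otimes> inv y \<in> V) M"
    proof (rule ccontr)
      assume "\<not> ?thesis"
      then have "\<forall>a\<in>A. eventually (\<lambda>y. \<not> (inv a \<otimes> y \<in> V \<and> a \<otimes> inv y \<in> V)) M" using M(3) by blast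
      then have "eventually (\<lambda>y. \<forall>a\<in>A. \<not> (inv a \<otimes> y \<in> V \<and> a \<otimes> inv y \<in> V)) M"
        by (rule eventually_ball_finite[OF A(1)])
      then have "eventually (\<lambda>y. (\<forall>a\<in>A. \<not> (inv a \<otimes> y \<in> V \<and> a \<otimes> inv y \<in> V)) \<and> y \<in> K) M"
        using inM[of K] by (intro eventually_conj) auto
      then show False using eventually_happens'[OF M(2)] A(3) by blast
    qed
    then obtain a where a: "a \<in> A" "eventually (\<lambda>y. inv a \<otimes> y \<in> V \<and> a \<otimes> inv y \<in> V) M" by blast
    have ac: "a \<in> carrier G" using a A by blast
    let ?X = "{y \<in> K. inv a \<otimes> y \<in> V \<and> a \<otimes> inv y \<in> V}"
    have "eventually (\<lambda>x. x \<in> ?X) M" using eventually_conj[OF inM[of K] a(2)] by simp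
    moreover have "inv y \<otimes> z \<in> U \<and> y \<otimes> inv z \<in> U" if "y \<in> ?X" "z \<in> ?X" for y z
    proof -
      have c: "y \<in> carrier G" "z \<in> carrier G" using that Kc by auto
      have "inv (inv a \<otimes> y) \<otimes> (inv a \<otimes> z) \<in> U" "inv (a \<otimes> inv y) \<otimes> (a \<otimes> inv z) \<in> U"
        using V(2) that by blast+
      then show ?thesis using ac c by (simp add: group_norm)
    qed
    ultimately show "\<exists>A. eventually (\<lambda>x. x \<in> A) M \<and> A \<subseteq> carrier G \<and>
        (\<forall>x\<in>A. \<forall>y\<in>A. inv x \<otimes> y \<in> U \<and> x \<otimes> inv y \<in> U)"
      using Kc by (intro exI[of _ ?X]) auto
  qed
  then obtain z where z: "nhds_limit G B M z" using complete M(2) unfolding nhds_complete_def by blast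
  then have zc: "z \<in> carrier G" by (simp add: nhds_limit_def)
  have "z \<in> C" if C: "C \<in> insert K \<U>" for C
  proof (rule ccontr)
    assume "z \<notin> C"
    have cl: "closedin (nhds_topology G B) C" using C \<U> K by blast
    then have "openin (nhds_topology G B) (carrier G - C)"
      by (simp add: closedin_def topspace_nhds_topology)
    then obtain U where U: "U \<in> B" "\<forall>u\<in>U. z \<otimes> u \<in> carrier G - C"
      unfolding openin_nhds_topology using zc \<open>z \<notin> C\<close> by blast
    have "eventually (\<lambda>x. inv z \<otimes> x \<in> U \<and> x \<in> C) M"
      using z U(1) inM[OF C] by (auto simp: nhds_limit_def intro: eventually_conj)
    then obtain x where x: "inv z \<otimes> x \<in> U" "x \<in> C" using eventually_happens'[OF M(2)] by blast
    have "x \<in> carrier G" using closedin_subset[OF cl] x(2) topspace_nhds_topology by blast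
    then have "z \<otimes> (inv z \<otimes> x) = x" using zc by (simp add: group_norm)
    then show False using U(2) x by (metis DiffD2)
  qed
  then show "K \<inter> \<Inter>\<U> \<noteq> {}" by blast
qed

section \<open>The quotient topology on the image\<close>

locale h_complete_image =
  fixes G :: "('a, 'm) monoid_scheme" and TG :: "'a topology"
    and H :: "('b, 'n) monoid_scheme" and TH :: "'b topology" and f :: "'a \<Rightarrow> 'b"
  assumes G: "topological_group G TG" and her: "hereditarily_h_complete G TG"
    and H: "topological_group H TH" and hom: "f \<in> hom G H" and cont: "continuous_map TG TH f"
    and onto: "f ` carrier G = carrier H"
begin

definition image_nhds :: "'b set set" where
  "image_nhds = (\<lambda>W. f ` W) ` {W. openin TG W \<and> \<one>\<^bsub>G\<^esub> \<in> W}"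

definition quotient_topology :: "'b topology" where
  "quotient_topology = nhds_topology H image_nhds"

lemma topspace_TG: "topspace TG = carrier G" using topological_groupD(2)[OF G] .

lemma topspace_TH: "topspace TH = carrier H" using topological_groupD(2)[OF H] .

sublocale f: group_hom G H f
  by (intro group_hom.intro group_hom_axioms.intro hom topological_groupD(1)[OF G] topological_groupD(1)[OF H])

sublocale Q: group_nhds H image_nhds
  unfolding image_nhds_def using f.H.is_group hom onto
  by (rule group_nhds.group_nhds_image[OF group_nhds_open[OF G]])

lemma topspace_quotient_topology: "topspace quotient_topology = carrier H"
  unfolding quotient_topology_def by (rule Q.topspace_nhds_topology)

lemma quotient_topology_finer:
  assumes V: "openin TH V"
  shows "openin quotient_topology V"
  unfolding quotient_topology_def Q.openin_nhds_topology
proof (intro conjI ballI)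
  show Vc: "V \<subseteq> carrier H" using openin_subset[OF V] topspace_TH by simp
  fix x assume x: "x \<in> V"
  then have xc: "x \<in> carrier H" using Vc by blast
  have "openin TH {y \<in> carrier H. x \<otimes>\<^bsub>H\<^esub> y \<in> V}"
    using openin_left_translate[OF H V, of "inv\<^bsub>H\<^esub> x"] xc by simp
  then have "openin TG {g \<in> topspace TG. f g \<in> {y \<in> carrier H. x \<otimes>\<^bsub>H\<^esub> y \<in> V}}"
    using cont by (rule openin_continuous_map_preimage[rotated])
  then have "f ` {g \<in> topspace TG. f g \<in> {y \<in> carrier H. x \<otimes>\<^bsub>H\<^esub> y \<in> V}} \<in> image_nhds"
    using x xc topspace_TG unfolding image_nhds_def by (intro imageI) auto
  then show "\<exists>U\<in>image_nhds. \<forall>u\<in>U. x \<otimes>\<^bsub>H\<^esub> u \<in> V" by (rule bexI[rotated]) auto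
qed

lemma topological_group_quotient_topology: "topological_group H quotient_topology"
  unfolding quotient_topology_def
proof (rule Q.topological_group_nhds_topology)
  have "x \<in> V" if x: "x \<in> \<Inter>image_nhds" and V: "openin TH V" "\<one>\<^bsub>H\<^esub> \<in> V" for x V
  proof -
    have "openin TG {g \<in> topspace TG. f g \<in> V}"
      using cont V(1) by (rule openin_continuous_map_preimage)
    then have "f ` {g \<in> topspace TG. f g \<in> V} \<in> image_nhds"
      using V(2) topspace_TG unfolding image_nhds_def by (intro imageI) auto
    then show ?thesis using x by auto
  qed
  then show "\<Inter>image_nhds \<subseteq> {\<one>\<^bsub>H\<^esub>}" using Inter_open_nhds[OF H] by blast
qed

lemma open_map_quotient_topology: "open_map TG quotient_topology f"
  unfolding open_map_def
proof (intro allI impI)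
  fix W assume W: "openin TG W"
  then have Wc: "W \<subseteq> carrier G" using openin_subset topspace_TG by blast
  show "openin quotient_topology (f ` W)"
    unfolding quotient_topology_def Q.openin_nhds_topology
  proof (intro conjI ballI)
    show "f ` W \<subseteq> carrier H" using Wc by auto
    fix y assume "y \<in> f ` W"
    then obtain x where x: "x \<in> W" "y = f x" by blast
    then have xc: "x \<in> carrier G" using Wc by blast
    have "openin TG {g \<in> carrier G. x \<otimes>\<^bsub>G\<^esub> g \<in> W}"
      using openin_left_translate[OF G W, of "inv\<^bsub>G\<^esub> x"] xc by simp
    then have "f ` {g \<in> carrier G. x \<otimes>\<^bsub>G\<^esub> g \<in> W} \<in> image_nhds"
      using x xc unfolding image_nhds_def by (intro imageI) auto
    moreover have "y \<otimes>\<^bsub>H\<^esub> f g \<in> f ` W" if "g \<in> carrier G" "x \<otimes>\<^bsub>G\<^esub> g \<in> W" for g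
      using that x xc f.hom_mult[of x g] by (metis imageI)
    ultimately show "\<exists>U\<in>image_nhds. \<forall>u\<in>U. y \<otimes>\<^bsub>H\<^esub> u \<in> f ` W"
      by (intro bexI[of _ "f ` {g \<in> carrier G. x \<otimes>\<^bsub>G\<^esub> g \<in> W}"]) auto
  qed
qed

lemma nhds_complete_image_nhds: "nhds_complete H image_nhds"
proof (rule h_complete_imp_nhds_complete[OF G _ Q.group_nhds_axioms hom onto])
  have "h_complete (G\<lparr>carrier := carrier G\<rparr>) (subtopology TG (carrier G))"
    using her f.G.subgroup_self closedin_topspace[of TG] topspace_TG
    unfolding hereditarily_h_complete_def by metis
  then show "h_complete G TG" using subtopology_topspace[of TG] topspace_TG by simp
  show "\<exists>W. openin TG W \<and> \<one>\<^bsub>G\<^esub> \<in> W \<and> f ` W \<subseteq> U" if "U \<in> image_nhds" for U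
    using that unfolding image_nhds_def by blast
qed

text \<open>
  At the identity of the subgroup \<open>R = f ` S\<close> the two topologies agree by \<open>open_on_separable_subgroup\<close>;
  translation within \<open>R\<close> carries this to the other points.
\<close>

lemma countable_agreement:
  assumes C: "countable C" "C \<subseteq> carrier H"
  obtains R where "C \<subseteq> R" "closedin TH R"
    "\<And>W. openin quotient_topology W \<Longrightarrow> openin (subtopology TH R) (W \<inter> R)"
proof -
  obtain S where S: "subgroup S G" "C \<subseteq> f ` S" "closedin TH (f ` S)"
    "\<And>W. openin TG W \<Longrightarrow> \<one>\<^bsub>G\<^esub> \<in> W \<Longrightarrow> \<exists>V. openin TH V \<and> \<one>\<^bsub>H\<^esub> \<in> V \<and> V \<inter> f ` S \<subseteq> f ` (W \<inter> S)"
    using open_on_separable_subgroup[OF G her H hom cont C(1)] C(2) onto by metis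
  define R where "R = f ` S"
  have R: "subgroup R H"
    unfolding R_def by (rule f.subgroup_img_is_subgroup[OF S(1)])
  have "openin (subtopology TH R) (W \<inter> R)" if W: "openin quotient_topology W" for W
  proof (subst openin_subopen, intro ballI)
    fix y assume y: "y \<in> W \<inter> R"
    then have yc: "y \<in> carrier H" using subgroup.subset[OF R] by blast
    obtain U where "U \<in> image_nhds" "\<forall>u\<in>U. y \<otimes>\<^bsub>H\<^esub> u \<in> W"
      using W y unfolding quotient_topology_def Q.openin_nhds_topology by blast
    then obtain X where X: "openin TG X" "\<one>\<^bsub>G\<^esub> \<in> X" "\<forall>u\<in>f ` X. y \<otimes>\<^bsub>H\<^esub> u \<in> W"
      unfolding image_nhds_def by blast
    obtain V where V: "openin TH V" "\<one>\<^bsub>H\<^esub> \<in> V" "V \<inter> R \<subseteq> f ` (X \<inter> S)"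
      using S(4)[OF X(1,2)] R_def by blast
    let ?V = "{z \<in> carrier H. inv\<^bsub>H\<^esub> y \<otimes>\<^bsub>H\<^esub> z \<in> V}"
    have "openin (subtopology TH R) (?V \<inter> R)"
      using openin_left_translate[OF H V(1) yc] unfolding openin_subtopology by blast
    moreover have "y \<in> ?V \<inter> R" using y yc V(2) by simp
    moreover have "?V \<inter> R \<subseteq> W \<inter> R"
    proof
      fix z assume z: "z \<in> ?V \<inter> R"
      then have "inv\<^bsub>H\<^esub> y \<otimes>\<^bsub>H\<^esub> z \<in> R"
        using y subgroup.m_closed[OF R subgroup.m_inv_closed[OF R]] by blast
      then have "inv\<^bsub>H\<^esub> y \<otimes>\<^bsub>H\<^esub> z \<in> f ` X" using z V(3) by blast
      then have "y \<otimes>\<^bsub>H\<^esub> (inv\<^bsub>H\<^esub> y \<otimes>\<^bsub>H\<^esub> z) \<in> W" using X(3) by blast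
      then show "z \<in> W \<inter> R" using z yc by (simp add: f.H.group_norm)
    qed
    ultimately show "\<exists>T. openin (subtopology TH R) T \<and> y \<in> T \<and> T \<subseteq> W \<inter> R" by blast
  qed
  then show thesis using that[of R] S(2,3) R_def by blast
qed

lemma closedin_Int_agreement:
  assumes F: "closedin quotient_topology F" and R: "closedin TH R"
    and agree: "\<And>W. openin quotient_topology W \<Longrightarrow> openin (subtopology TH R) (W \<inter> R)"
  shows "closedin TH (F \<inter> R)"
proof -
  have Rc: "R \<subseteq> carrier H" using closedin_subset[OF R] topspace_TH by simp
  have "openin (subtopology TH R) ((carrier H - F) \<inter> R)"
    using F agree unfolding closedin_def topspace_quotient_topology by blast
  then have "closedin (subtopology TH R) (topspace (subtopology TH R) - (carrier H - F) \<inter> R)"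
    by (rule closedin_diff[OF closedin_topspace])
  moreover have "topspace (subtopology TH R) - (carrier H - F) \<inter> R = F \<inter> R"
    using Rc by (auto simp: topspace_TH)
  ultimately have "closedin (subtopology TH R) (F \<inter> R)" by simp
  then show ?thesis using R by (rule closedin_trans_full)
qed

text \<open>
  On a closed set \<open>R\<close> that contains the countable set and on which the topologies agree, \<open>F \<inter> R\<close> is
  closed for the topology of \<open>H\<close> as well.
\<close>

lemma omega_closed_if_quotient_closed:
  assumes F: "closedin quotient_topology F"
  shows "omega_closed TH F"
  unfolding omega_closed_def
proof (intro conjI allI impI)
  show Fc: "F \<subseteq> topspace TH" using closedin_subset[OF F] topspace_TH topspace_quotient_topology by simp
  fix C assume C: "countable C \<and> C \<subseteq> F"
  then obtain R where R: "C \<subseteq> R" "closedin TH R"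
    "\<And>W. openin quotient_topology W \<Longrightarrow> openin (subtopology TH R) (W \<inter> R)"
    using countable_agreement[of C] Fc topspace_TH by (metis subset_trans)
  have "TH closure_of C \<subseteq> F \<inter> R"
    using C R(1) closedin_Int_agreement[OF F R(2,3)] by (intro closure_of_minimal) auto
  then show "TH closure_of C \<subseteq> F" by blast
qed

lemma compactin_Int_agreement:
  assumes K: "compactin TH K" and R: "closedin TH R"
    and agree: "\<And>W. openin quotient_topology W \<Longrightarrow> openin (subtopology TH R) (W \<inter> R)"
  shows "compactin quotient_topology (K \<inter> R)"
proof -
  have Rc: "R \<subseteq> carrier H" using closedin_subset[OF R] topspace_TH by simp
  have "continuous_map (subtopology TH R) quotient_topology id"
    unfolding continuous_map_def topspace_quotient_topology
  proof (intro conjI allI impI)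
    show "id \<in> topspace (subtopology TH R) \<rightarrow> carrier H" using Rc by auto
    fix W assume W: "openin quotient_topology W"
    have "{x \<in> topspace (subtopology TH R). id x \<in> W} = W \<inter> R" using Rc by (auto simp: topspace_TH)
    then show "openin (subtopology TH R) {x \<in> topspace (subtopology TH R). id x \<in> W}"
      using agree[OF W] by simp
  qed
  moreover have "compactin (subtopology TH R) (K \<inter> R)"
    using compact_Int_closedin[OF K R] by (simp add: compactin_subtopology)
  ultimately show ?thesis using image_compactin by fastforce
qed

text \<open>
  Otherwise \<open>K\<close> contains a sequence no two terms of which are \<open>U\<close>-close. It lies in a closed set
  \<open>R\<close> on which the topologies agree, so \<open>K \<inter> R\<close> is compact for the quotient topology. Finitely many
  \<open>U\<close>-small open sets then cover the sequence, and one of them contains two of its terms.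
\<close>

lemma totally_bounded_compact:
  assumes K: "compactin TH K" and U: "U \<in> image_nhds"
  shows "\<exists>A. finite A \<and> A \<subseteq> carrier H \<and> (\<forall>y\<in>K. \<exists>a\<in>A. inv\<^bsub>H\<^esub> a \<otimes>\<^bsub>H\<^esub> y \<in> U \<and> a \<otimes>\<^bsub>H\<^esub> inv\<^bsub>H\<^esub> y \<in> U)"
proof (rule ccontr)
  assume no: "\<not> ?thesis"
  define E where "E = (\<lambda>a y. inv\<^bsub>H\<^esub> a \<otimes>\<^bsub>H\<^esub> y \<in> U \<and> a \<otimes>\<^bsub>H\<^esub> inv\<^bsub>H\<^esub> y \<in> U)"
  have Kc: "K \<subseteq> carrier H" using compactin_subset_topspace[OF K] topspace_TH by simp
  have escape: "\<exists>y\<in>K. \<forall>a\<in>A. \<not> E a y" if "finite A" "A \<subseteq> carrier H" for A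
    using no that unfolding E_def by meson
  have "\<exists>x::nat \<Rightarrow> 'b. \<forall>n. x n \<in> K \<and> (\<forall>m<n. \<not> E (x m) (x n))"
  proof (rule dependent_wellorder_choice)
    fix n :: nat and x :: "nat \<Rightarrow> 'b"
    assume IH: "\<And>m. m < n \<Longrightarrow> x m \<in> K \<and> (\<forall>i<m. \<not> E (x i) (x m))"
    have "x ` {..<n} \<subseteq> carrier H"
    proof (rule image_subsetI)
      fix m assume "m \<in> {..<n}"
      then show "x m \<in> carrier H" using IH[of m] Kc by auto
    qed
    then obtain y where "y \<in> K" "\<forall>a\<in>x ` {..<n}. \<not> E a y"
      using escape[of "x ` {..<n}"] by auto
    then show "\<exists>y. y \<in> K \<and> (\<forall>m<n. \<not> E (x m) y)" by auto
  qed simp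
  then obtain x :: "nat \<Rightarrow> 'b" where x: "\<And>n. x n \<in> K" "\<And>m n. m < n \<Longrightarrow> \<not> E (x m) (x n)" by blast
  have xc: "range x \<subseteq> carrier H" using x(1) Kc by blast
  obtain R where R: "range x \<subseteq> R" "closedin TH R"
    "\<And>W. openin quotient_topology W \<Longrightarrow> openin (subtopology TH R) (W \<inter> R)"
    using countable_agreement[OF _ xc] by (metis countableI_type countable_image)
  have KR: "compactin quotient_topology (K \<inter> R)" by (rule compactin_Int_agreement[OF K R(2,3)])
  obtain V where V: "V \<in> image_nhds" "\<And>x y. x \<in> V \<Longrightarrow> y \<in> V \<Longrightarrow> inv\<^bsub>H\<^esub> x \<otimes>\<^bsub>H\<^esub> y \<in> U"
      "\<And>x y. x \<in> V \<Longrightarrow> y \<in> V \<Longrightarrow> x \<otimes>\<^bsub>H\<^esub> inv\<^bsub>H\<^esub> y \<in> U"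
    using Q.small[OF U] by metis
  define \<O> where "\<O> = {W. openin quotient_topology W \<and> (\<forall>y\<in>W. \<forall>z\<in>W. E y z)}"
  have "c \<in> \<Union>\<O>" if c: "c \<in> carrier H" for c
  proof -
    obtain V1 where V1: "V1 \<in> image_nhds" "\<forall>v\<in>V1. c \<otimes>\<^bsub>H\<^esub> v \<otimes>\<^bsub>H\<^esub> inv\<^bsub>H\<^esub> c \<in> V"
      using Q.small_conj[OF c V(1)] by blast
    obtain V2 where V2: "V2 \<in> image_nhds" "V2 \<subseteq> V \<inter> V1" using Q.directed[OF V(1) V1(1)] by blast
    obtain W where W: "openin quotient_topology W" "c \<in> W" "\<And>y. y \<in> W \<Longrightarrow> inv\<^bsub>H\<^esub> c \<otimes>\<^bsub>H\<^esub> y \<in> V2"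
      using Q.open_nhd[OF V2(1) c] unfolding quotient_topology_def by metis
    have "E y z" if yz: "y \<in> W" "z \<in> W" for y z
    proof -
      have yzc: "y \<in> carrier H" "z \<in> carrier H"
        using openin_subset[OF W(1)] yz topspace_quotient_topology by auto
      let ?a = "inv\<^bsub>H\<^esub> c \<otimes>\<^bsub>H\<^esub> y" and ?b = "inv\<^bsub>H\<^esub> c \<otimes>\<^bsub>H\<^esub> z"
      have ab: "?a \<in> V2" "?b \<in> V2" using W(3) yz by blast+
      have "inv\<^bsub>H\<^esub> ?a \<otimes>\<^bsub>H\<^esub> ?b \<in> U" using ab V(2) V2(2) by blast
      moreover have "(c \<otimes>\<^bsub>H\<^esub> ?a \<otimes>\<^bsub>H\<^esub> inv\<^bsub>H\<^esub> c) \<otimes>\<^bsub>H\<^esub> inv\<^bsub>H\<^esub> (c \<otimes>\<^bsub>H\<^esub> ?b \<otimes>\<^bsub>H\<^esub> inv\<^bsub>H\<^esub> c) \<in> U"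
        using ab V(3) V1(2) V2(2) by blast
      ultimately show ?thesis using c yzc by (simp add: E_def f.H.group_norm)
    qed
    then show ?thesis using W(1,2) unfolding \<O>_def by blast
  qed
  then have "K \<inter> R \<subseteq> \<Union>\<O>" using Kc by blast
  then obtain \<F> where \<F>: "finite \<F>" "\<F> \<subseteq> \<O>" "K \<inter> R \<subseteq> \<Union>\<F>"
    using compactinD[OF KR, of \<O>] unfolding \<O>_def by blast
  have "\<exists>W\<in>\<F>. x n \<in> W" for n using x(1)[of n] R(1) \<F>(3) by blast
  then obtain \<phi> where \<phi>: "\<And>n. \<phi> n \<in> \<F>" "\<And>n. x n \<in> \<phi> n" by metis
  have "\<not> inj \<phi>"
    using finite_imageD[of \<phi> UNIV] finite_subset[of "range \<phi>" \<F>] \<phi>(1) \<F>(1) by auto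
  then obtain m n where "m \<noteq> n" "\<phi> m = \<phi> n" unfolding inj_def by blast
  then obtain m n where mn: "m < n" "\<phi> m = \<phi> n" by (metis linorder_neqE_nat)
  have "E (x m) (x n)" using \<phi>(1)[of m] \<phi>(2)[of m] \<phi>(2)[of n] mn(2) \<F>(2) unfolding \<O>_def by auto
  then show False using x(2)[OF mn(1)] by blast
qed

lemma compactin_quotient:
  assumes K: "compactin TH K"
  shows "compactin quotient_topology K"
proof -
  have "closedin TH K" using compactin_imp_closedin[OF topological_groupD(3)[OF H] K] .
  then have "closedin quotient_topology K"
    using quotient_topology_finer unfolding closedin_def topspace_TH topspace_quotient_topology by blast
  then show ?thesis
    unfolding quotient_topology_def
    using nhds_complete_image_nhds totally_bounded_compact[OF K]
    by (intro Q.compactin_if_complete_totally_bounded)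
qed

text \<open>
  On \<open>K\<close> the identity is a continuous bijection from the quotient topology, which is compact there,
  onto the Hausdorff topology of \<open>H\<close>, and hence a homeomorphism.
\<close>

lemma k_continuous_map_id: "k_continuous_map TH quotient_topology id"
  unfolding k_continuous_map_def
proof (intro allI impI)
  fix K assume K: "compactin TH K"
  have "homeomorphic_map (subtopology quotient_topology K) (subtopology TH K) id"
  proof (rule continuous_imp_homeomorphic_map)
    show "compact_space (subtopology quotient_topology K)"
      using compactin_quotient[OF K] by (rule compact_space_subtopology)
    show "Hausdorff_space (subtopology TH K)"
      using topological_groupD(3)[OF H] by (rule Hausdorff_space_subtopology)
    show "continuous_map (subtopology quotient_topology K) (subtopology TH K) id"
      unfolding continuous_map_def
    proof (intro conjI allI impI)
      fix W assume "openin (subtopology TH K) W"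
      then obtain V where V: "openin TH V" "W = V \<inter> K" unfolding openin_subtopology by blast
      have "{x \<in> topspace (subtopology quotient_topology K). id x \<in> W} = V \<inter> K"
        using openin_subset[OF V(1)] V(2) topspace_TH topspace_quotient_topology by auto
      then show "openin (subtopology quotient_topology K)
          {x \<in> topspace (subtopology quotient_topology K). id x \<in> W}"
        using quotient_topology_finer[OF V(1)] unfolding openin_subtopology by blast
    qed (simp add: topspace_TH topspace_quotient_topology)
  qed (simp_all add: topspace_TH topspace_quotient_topology)
  then have "subtopology TH K = subtopology quotient_topology K" by simp
  then show "continuous_map (subtopology TH K) quotient_topology id"
    by (simp add: continuous_map_from_subtopology)
qed

end

section \<open>Openness of the homomorphism\<close>

theorem theorem2p3:
  fixes G :: "('a, 'm) monoid_scheme" and TG :: "'a topology"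
    and H :: "('b, 'n) monoid_scheme" and TH :: "'b topology"
    and f :: "'a \<Rightarrow> 'b"
  assumes "topological_group G TG"
    and "hereditarily_h_complete G TG"
    and "topological_group H TH"
    and "f \<in> hom G H"
    and "continuous_map TG TH f"
    and "f ` carrier G = carrier H"
    and "countable_tightness TH \<or> k_group H TH"
  shows "open_map TG TH f"
proof -
  interpret h_complete_image G TG H TH f
    using assms(1-6) by (rule h_complete_image.intro)
  have "openin TH W" if W: "openin quotient_topology W" for W
    using assms(7)
  proof
    assume "countable_tightness TH"
    moreover have "closedin quotient_topology (carrier H - W)"
      using closedin_diff[OF closedin_topspace W] topspace_quotient_topology by simp
    ultimately have "closedin TH (carrier H - W)"
      using omega_closed_if_quotient_closed unfolding countable_tightness_def by blast
    then have "openin TH (carrier H - (carrier H - W))"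
      unfolding closedin_def topspace_TH by blast
    moreover have "W \<subseteq> carrier H" using openin_subset[OF W] topspace_quotient_topology by simp
    ultimately show ?thesis by (simp add: double_diff)
  next
    assume k: "k_group H TH"
    have "continuous_map TH quotient_topology id"
      by (rule k_group_continuous[OF f.H.is_group topspace_TH k
            topological_group_quotient_topology _ k_continuous_map_id]) (simp add: hom_def)
    then have "openin TH {x \<in> topspace TH. id x \<in> W}"
      using W by (rule openin_continuous_map_preimage)
    moreover have "{x \<in> topspace TH. id x \<in> W} = W"
      using openin_subset[OF W] topspace_quotient_topology topspace_TH by auto
    ultimately show ?thesis by simp
  qed
  then show ?thesis using open_map_quotient_topology unfolding open_map_def by blast
qed

end
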